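(* Fix an integer $n\ge 4$. If the $n$-th Gleason polynomial $G_n\in\mathbb{Q}[c]$ is irreducible over $\mathbb{Q}$, then the curve $\mathrm{Per}_n(0)$ is irreducible over $\mathbb{C}$.
   Context: The $n$-th Gleason polynomial $G_n\in\mathbb{Q}[c]$ is the polynomial whose roots (each simple) are exactly the $c\in\mathbb{C}$ such that, under $f_c(z)=z^2+c$, the critical point $0$ is periodic of exact period $n$. $\mathcal{M}_2$ denotes the moduli space of quadratic (degree-$2$) rational self-maps of $\mathbb{P}^1$ up to conjugacy by automorphisms of $\mathbb{P}^1$; it is isomorphic to $\mathbb{A}^2$, over $\mathbb{C}$ and over $\mathbb{Q}$. $\mathrm{Per}_n(0)\subsetneq\mathcal{M}_2$ is the one-dimensional $\mathbb{Q}$-subvariety parametrizing conjugacy classes of maps having a critical point that is periodic of exact period $n$. *)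

theory Defs
  imports "HOL-Analysis.Analysis" "HOL-Computational_Algebra.Computational_Algebra"
begin

section \<open>Exact periods and Gleason polynomials\<close>

definition has_exact_period :: "('a \<Rightarrow> 'a) \<Rightarrow> nat \<Rightarrow> 'a \<Rightarrow> bool" where
  "has_exact_period f n x \<longleftrightarrow>
     n > 0 \<and> (f ^^ n) x = x \<and> (\<forall>k. 0 < k \<and> k < n \<longrightarrow> (f ^^ k) x \<noteq> x)"

text \<open>
  The roots determine \<open>G\<close> up to a nonzero rational factor, which affects neither the
  condition below nor irreducibility; no normalisation is imposed.
\<close>

definition is_gleason_poly :: "nat \<Rightarrow> rat poly \<Rightarrow> bool" where
  "is_gleason_poly n G \<longleftrightarrow>
     rsquarefree (map_poly of_rat G :: complex poly) \<and>
     (\<forall>c::complex. poly (map_poly of_rat G) c = 0 \<longleftrightarrow>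
        has_exact_period (\<lambda>z. z\<^sup>2 + c) n 0)"


section \<open>Rational self-maps of the complex projective line\<close>

datatype proj_line = Aff complex | Infty

text \<open>
  A pair \<open>(p, q)\<close> of coprime polynomials with \<open>max (degree p) (degree q) = d\<close> stands for the
  map \<open>p / q\<close> of degree \<open>d\<close>.  The pairs of degree \<open>d\<close> are the vectors of coefficients, in
  affine space of dimension \<open>2 * d + 2\<close>, at which the resultant of the two associated binary
  forms of degree \<open>d\<close> does not vanish.  Two such pairs give the same map iff they are
  proportional.
\<close>

definition coprime_pairs :: "nat \<Rightarrow> (complex poly \<times> complex poly) set" where
  "coprime_pairs d = {(p, q). coprime p q \<and> max (degree p) (degree q) = d}"

fun ratmap :: "complex poly \<times> complex poly \<Rightarrow> proj_line \<Rightarrow> proj_line" where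
  "ratmap (p, q) (Aff z) =
     (if poly q z = 0 then Infty else Aff (poly p z / poly q z))"
| "ratmap (p, q) Infty =
     (let d = max (degree p) (degree q)
      in if coeff q d = 0 then Infty else Aff (coeff p d / coeff q d))"

definition rational_maps :: "nat \<Rightarrow> (proj_line \<Rightarrow> proj_line) set" where
  "rational_maps d = ratmap ` coprime_pairs d"

text \<open>
  \<open>coord x\<close> is the standard affine coordinate around \<open>x\<close> (namely \<open>z\<close> or \<open>1 / z\<close>) and
  \<open>param x\<close> its inverse.  The value of \<open>coord x\<close> at the point outside the chart is immaterial:
  \<open>critical_point\<close> only looks at a neighbourhood of \<open>x\<close>, mapped near \<open>f x\<close>.
\<close>

fun coord :: "proj_line \<Rightarrow> proj_line \<Rightarrow> complex" where
  "coord (Aff _) (Aff z) = z"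
| "coord (Aff _) Infty = 0"
| "coord Infty (Aff z) = inverse z"
| "coord Infty Infty = 0"

fun param :: "proj_line \<Rightarrow> complex \<Rightarrow> proj_line" where
  "param (Aff _) t = Aff t"
| "param Infty t = (if t = 0 then Infty else Aff (inverse t))"

definition critical_point :: "(proj_line \<Rightarrow> proj_line) \<Rightarrow> proj_line \<Rightarrow> bool" where
  "critical_point f x \<longleftrightarrow>
     ((\<lambda>t. coord (f x) (f (param x t))) has_field_derivative 0) (at (coord x x))"


section \<open>The moduli space of quadratic rational maps\<close>

text \<open>\<open>rational_maps 1\<close> is the group of automorphisms of the projective line.\<close>

definition conj_rel :: "((proj_line \<Rightarrow> proj_line) \<times> (proj_line \<Rightarrow> proj_line)) set" where
  "conj_rel = {(f, g). f \<in> rational_maps 2 \<and> g \<in> rational_maps 2 \<and>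
                 (\<exists>\<mu>\<in>rational_maps 1. \<mu> \<circ> f = g \<circ> \<mu>)}"

definition M2 :: "(proj_line \<Rightarrow> proj_line) set set" where
  "M2 = rational_maps 2 // conj_rel"

definition conj_class_of_pair ::
    "complex poly \<times> complex poly \<Rightarrow> (proj_line \<Rightarrow> proj_line) set" where
  "conj_class_of_pair r = conj_rel `` {ratmap r}"

text \<open>
  Polynomial functions of the coefficients.  On \<open>coprime_pairs d\<close> the coefficients of index
  greater than \<open>d\<close> vanish, so these are the polynomials in the remaining \<open>2 * d + 2\<close> ones.
\<close>

inductive coeff_polyfun :: "(complex poly \<times> complex poly \<Rightarrow> complex) \<Rightarrow> bool" where
  const: "coeff_polyfun (\<lambda>r. c)"
| numer: "coeff_polyfun (\<lambda>r. coeff (fst r) i)"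
| denom: "coeff_polyfun (\<lambda>r. coeff (snd r) i)"
| add: "coeff_polyfun F \<Longrightarrow> coeff_polyfun G \<Longrightarrow> coeff_polyfun (\<lambda>r. F r + G r)"
| mult: "coeff_polyfun F \<Longrightarrow> coeff_polyfun G \<Longrightarrow> coeff_polyfun (\<lambda>r. F r * G r)"

definition zariski_pairs :: "nat \<Rightarrow> (complex poly \<times> complex poly) topology" where
  "zariski_pairs d = topology (\<lambda>U. \<exists>\<F>. (\<forall>F\<in>\<F>. coeff_polyfun F) \<and>
     U = {r \<in> coprime_pairs d. \<exists>F\<in>\<F>. F r \<noteq> 0})"

text \<open>
  The variety \<open>M2\<close> (isomorphic to the affine plane) is the geometric quotient of the space of
  quadratic rational maps by conjugation, and the latter is the quotient of the space of
  coefficient pairs by scaling.  Hence the Zariski topology of \<open>M2\<close> is the quotient of the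
  Zariski topology on coefficient pairs.
\<close>

definition zariski_M2 :: "(proj_line \<Rightarrow> proj_line) set topology" where
  "zariski_M2 = topology (\<lambda>U. U \<subseteq> M2 \<and>
     openin (zariski_pairs 2) {r \<in> coprime_pairs 2. conj_class_of_pair r \<in> U})"

definition Per_zero :: "nat \<Rightarrow> (proj_line \<Rightarrow> proj_line) set set" where
  "Per_zero n = {C \<in> M2. \<exists>f\<in>C. \<exists>x. critical_point f x \<and> has_exact_period f n x}"

definition irreducible_space :: "'a topology \<Rightarrow> bool" where
  "irreducible_space X \<longleftrightarrow> topspace X \<noteq> {} \<and>
     (\<forall>A B. closedin X A \<and> closedin X B \<and> A \<union> B = topspace X
        \<longrightarrow> A = topspace X \<or> B = topspace X)"


section \<open>The two topologies are well defined\<close>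

lemma openin_zariski_pairs:
  "openin (zariski_pairs d) U \<longleftrightarrow>
     (\<exists>\<F>. (\<forall>F\<in>\<F>. coeff_polyfun F) \<and> U = {r \<in> coprime_pairs d. \<exists>F\<in>\<F>. F r \<noteq> 0})"
proof -
  let ?P = "\<lambda>U. \<exists>\<F>. (\<forall>F\<in>\<F>. coeff_polyfun F) \<and>
     U = {r \<in> coprime_pairs d. \<exists>F\<in>\<F>. F r \<noteq> 0}"
  have "?P (S \<inter> T)" if S: "?P S" and T: "?P T" for S T
  proof -
    obtain \<F> where F: "\<forall>F\<in>\<F>. coeff_polyfun F"
      "S = {r \<in> coprime_pairs d. \<exists>F\<in>\<F>. F r \<noteq> 0}" using S by blast
    obtain \<G> where G: "\<forall>F\<in>\<G>. coeff_polyfun F"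
      "T = {r \<in> coprime_pairs d. \<exists>F\<in>\<G>. F r \<noteq> 0}" using T by blast
    let ?H = "{\<lambda>r. F r * G r |F G. F \<in> \<F> \<and> G \<in> \<G>}"
    have "\<forall>F\<in>?H. coeff_polyfun F" using F G by (auto intro: coeff_polyfun.mult)
    moreover have "S \<inter> T = {r \<in> coprime_pairs d. \<exists>F\<in>?H. F r \<noteq> 0}"
      unfolding F(2) G(2) by fastforce
    ultimately show ?thesis by blast
  qed
  moreover have "?P (\<Union>\<K>)" if K: "\<forall>K\<in>\<K>. ?P K" for \<K>
  proof -
    from bchoice[OF K] obtain f where f: "\<forall>K\<in>\<K>. (\<forall>F\<in>f K. coeff_polyfun F) \<and>
      K = {r \<in> coprime_pairs d. \<exists>F\<in>f K. F r \<noteq> 0}" by blast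
    have "\<forall>F\<in>\<Union>(f ` \<K>). coeff_polyfun F" using f by blast
    moreover have "\<Union>\<K> = {r \<in> coprime_pairs d. \<exists>F\<in>\<Union>(f ` \<K>). F r \<noteq> 0}"
      using f by blast
    ultimately show ?thesis by blast
  qed
  ultimately have "istopology ?P" unfolding istopology_def by blast
  then show ?thesis by (simp add: zariski_pairs_def topology_inverse')
qed

lemma topspace_zariski_pairs [simp]: "topspace (zariski_pairs d) = coprime_pairs d"
proof -
  have "openin (zariski_pairs d) (coprime_pairs d)"
    unfolding openin_zariski_pairs
    by (rule exI[of _ "{\<lambda>r. 1}"]) (auto intro: coeff_polyfun.const)
  moreover have "topspace (zariski_pairs d) \<subseteq> coprime_pairs d"
    using openin_topspace[of "zariski_pairs d"] unfolding openin_zariski_pairs by blast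
  ultimately show ?thesis using openin_subset by blast
qed

lemma openin_zariski_M2:
  "openin zariski_M2 U \<longleftrightarrow> U \<subseteq> M2 \<and>
     openin (zariski_pairs 2) {r \<in> coprime_pairs 2. conj_class_of_pair r \<in> U}"
proof -
  let ?pre = "\<lambda>U. {r \<in> coprime_pairs 2. conj_class_of_pair r \<in> U}"
  let ?P = "\<lambda>U. U \<subseteq> M2 \<and> openin (zariski_pairs 2) (?pre U)"
  have "?P (S \<inter> T)" if "?P S" "?P T" for S T
  proof -
    have "?pre (S \<inter> T) = ?pre S \<inter> ?pre T" by blast
    with that show ?thesis by auto
  qed
  moreover have "?P (\<Union>\<K>)" if "\<forall>K\<in>\<K>. ?P K" for \<K>
  proof -
    have "?pre (\<Union>\<K>) = \<Union>(?pre ` \<K>)" by blast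
    with that show ?thesis by auto
  qed
  ultimately have "istopology ?P" unfolding istopology_def by blast
  then show ?thesis by (simp add: zariski_M2_def topology_inverse')
qed

lemma conj_class_of_pair_image: "conj_class_of_pair ` coprime_pairs 2 = M2"
  by (auto simp: conj_class_of_pair_def M2_def rational_maps_def quotient_def)

lemma topspace_zariski_M2 [simp]: "topspace zariski_M2 = M2"
proof -
  have "{r \<in> coprime_pairs 2. conj_class_of_pair r \<in> M2} = topspace (zariski_pairs 2)"
    using conj_class_of_pair_image by auto
  then have "openin zariski_M2 M2"
    unfolding openin_zariski_M2 by (metis openin_topspace order_refl)
  moreover have "topspace zariski_M2 \<subseteq> M2"
    using openin_topspace[of zariski_M2] unfolding openin_zariski_M2 by blast
  ultimately show ?thesis using openin_subset by blast
qed

lemma quotient_map_conj_class: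
  "quotient_map (zariski_pairs 2) zariski_M2 conj_class_of_pair"
  by (auto simp: quotient_map_def conj_class_of_pair_image openin_zariski_M2)

end

theory Submission
  imports Defs "HOL-Computational_Algebra.Field_as_Ring" "HOL-Library.Z2"
begin

text \<open>
  A map with a critical point of exact period \<open>n \<ge> 3\<close> is conjugate to
  \<open>f z = 1 + b / z + c / z\<^sup>2\<close> with \<open>0 \<mapsto> \<infinity> \<mapsto> 1\<close>.  Thus \<open>Per\<^sub>n(0)\<close> is the
  image of a part of the plane curve \<open>A\<^sub>n(b, c) = 0\<close>, where \<open>A\<^sub>n\<close> is the numerator of
  \<open>f\<^sup>n(0)\<close>, and it is enough that all prime factors of \<open>A\<^sub>n\<close> over \<open>\<complex>\<close> that do not divide
  \<open>c\<close> or an earlier \<open>A\<^sub>k\<close> are associated.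

  The curve has a branch at infinity, \<open>b = 1 / t\<close>, \<open>c \<in> \<rat>((t))\<close>, so the component \<open>H\<close>
  containing it is defined over \<open>\<rat>\<close>.  The polynomial maps form a rational curve in the
  \<open>(b, c)\<close>-plane, on which \<open>A\<^sub>n\<close> restricts to the polynomial \<open>f\<^sub>C\<^sup>n(0)\<close> of the quadratic
  family up to units; its roots are simple.  Every component meets that curve, because with
  weights 2 and 3 for \<open>b\<close> and \<open>c\<close> the leading form of \<open>A\<^sub>n\<close> is a power of \<open>c\<close>; and the
  points of intersection are roots of \<open>G\<close>.  As \<open>G\<close> is irreducible and \<open>H\<close> is rational,
  \<open>H\<close> vanishes at all roots of \<open>G\<close>.  A second component would meet \<open>H\<close> at one of them,
  producing a multiple root.
\<close>

subsection \<open>Polynomials in two variables\<close>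

definition ring_hom_fun :: "('a::comm_ring_1 \<Rightarrow> 'b::comm_ring_1) \<Rightarrow> bool" where
  "ring_hom_fun h \<longleftrightarrow> h 0 = 0 \<and> h 1 = 1 \<and> (\<forall>x y. h (x + y) = h x + h y) \<and> (\<forall>x y. h (x * y) = h x * h y)"

lemma ring_hom_funD:
  assumes "ring_hom_fun h"
  shows "h 0 = 0" "h 1 = 1" "h (x + y) = h x + h y" "h (x * y) = h x * h y"
  using assms unfolding ring_hom_fun_def by auto

lemma ring_hom_fun_sum: "ring_hom_fun h \<Longrightarrow> h (sum f A) = (\<Sum>x\<in>A. h (f x))"
  by (induction A rule: infinite_finite_induct) (auto simp: ring_hom_funD)

lemma ring_hom_fun_prod: "ring_hom_fun h \<Longrightarrow> h (prod f A) = (\<Prod>x\<in>A. h (f x))"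
  by (induction A rule: infinite_finite_induct) (auto simp: ring_hom_funD)

lemma ring_hom_fun_power: "ring_hom_fun h \<Longrightarrow> h (x ^ n) = h x ^ n"
  by (induction n) (auto simp: ring_hom_funD)

lemma ring_hom_fun_dvd: "ring_hom_fun h \<Longrightarrow> x dvd y \<Longrightarrow> h x dvd h y"
  by (auto simp: dvd_def ring_hom_funD)

lemma map_poly_mult_hom:
  assumes "ring_hom_fun h"
  shows "map_poly h (p * q) = map_poly h p * map_poly h q"
  by (rule poly_eqI)
     (simp add: coeff_map_poly ring_hom_funD[OF assms] coeff_mult ring_hom_fun_sum[OF assms])

lemma map_poly_add_hom:
  assumes "h 0 = 0" "\<And>x y. h (x + y) = h x + h y"
  shows "map_poly h (p + q) = map_poly h p + map_poly h q"
  by (rule poly_eqI) (simp add: coeff_map_poly assms)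

lemma ring_hom_fun_map_poly: "ring_hom_fun h \<Longrightarrow> ring_hom_fun (map_poly h)"
  unfolding ring_hom_fun_def[of "map_poly h"]
  by (auto simp: map_poly_mult_hom map_poly_add_hom ring_hom_funD)

lemma ring_hom_fun_poly: "ring_hom_fun (\<lambda>p. poly p z)"
  by (simp add: ring_hom_fun_def)

lemma ring_hom_fun_comp: "ring_hom_fun g \<Longrightarrow> ring_hom_fun h \<Longrightarrow> ring_hom_fun (\<lambda>x. g (h x))"
  by (simp add: ring_hom_fun_def)

lemma ring_hom_fun_poly_map: "ring_hom_fun h \<Longrightarrow> ring_hom_fun (\<lambda>p. poly (map_poly h p) z)"
  by (rule ring_hom_fun_comp[OF ring_hom_fun_poly ring_hom_fun_map_poly])

lemma hom_poly_map_poly: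
  assumes "ring_hom_fun g" "ring_hom_fun h"
  shows "g (poly (map_poly h p) z) = poly (map_poly (\<lambda>x. g (h x)) p) (g z)"
  using assms by (induction p) (auto simp: map_poly_pCons ring_hom_funD)

text \<open>In \<open>'a poly poly\<close> the inner variable stands for \<open>b\<close> and the outer one for \<open>c\<close>.\<close>

definition eval2 :: "('a::comm_ring_1 \<Rightarrow> 'b::comm_ring_1) \<Rightarrow> 'b \<Rightarrow> 'b \<Rightarrow> 'a poly poly \<Rightarrow> 'b" where
  "eval2 h \<beta> \<gamma> P = poly (map_poly (\<lambda>p. poly (map_poly h p) \<beta>) P) \<gamma>"

lemma ring_hom_fun_eval2: "ring_hom_fun h \<Longrightarrow> ring_hom_fun (eval2 h \<beta> \<gamma>)"
  unfolding eval2_def[abs_def] by (intro ring_hom_fun_poly_map)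

lemma hom_eval2:
  assumes g: "ring_hom_fun g" and h: "ring_hom_fun h"
  shows "g (eval2 h \<beta> \<gamma> P) = eval2 (\<lambda>x. g (h x)) (g \<beta>) (g \<gamma>) P"
  unfolding eval2_def hom_poly_map_poly[OF g ring_hom_fun_poly_map[OF h]]
  by (simp add: hom_poly_map_poly[OF g h])

lemma eval2_pCons:
  "ring_hom_fun h \<Longrightarrow> eval2 h \<beta> \<gamma> (pCons p P) = poly (map_poly h p) \<beta> + \<gamma> * eval2 h \<beta> \<gamma> P"
  by (auto simp: eval2_def map_poly_pCons ring_hom_funD)

lemma eval2_0 [simp]: "eval2 h \<beta> \<gamma> 0 = 0"
  by (simp add: eval2_def)

lemma eval2_const: "ring_hom_fun h \<Longrightarrow> eval2 h \<beta> \<gamma> [:p:] = poly (map_poly h p) \<beta>"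
  by (simp add: eval2_pCons)

lemma eval2_vars:
  assumes "ring_hom_fun h"
  shows "eval2 h \<beta> \<gamma> [:[:0, 1:]:] = \<beta>" "eval2 h \<beta> \<gamma> [:0, 1:] = \<gamma>"
  by (simp_all add: eval2_pCons[OF assms] map_poly_pCons ring_hom_funD[OF assms] assms)

abbreviation ev :: "complex poly poly \<Rightarrow> complex \<Rightarrow> complex \<Rightarrow> complex" where
  "ev P b c \<equiv> eval2 (\<lambda>x. x) b c P"

lemma ring_hom_fun_id: "ring_hom_fun (\<lambda>x. x)"
  by (simp add: ring_hom_fun_def)

lemmas hom_ev = ring_hom_fun_eval2[OF ring_hom_fun_id]
lemmas ev_simps = ring_hom_funD[OF hom_ev]

lemma ev_eq: "ev P b c = poly (map_poly (\<lambda>p. poly p b) P) c"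
  by (simp add: eval2_def)

section \<open>Elimination and divisibility of plane curves\<close>

text \<open>By pseudo-division, an element \<open>D\<close> of least degree in the ideal of
  \<open>H\<close> and \<open>P\<close> divides a nonzero constant multiple of every element.
  Primality of \<open>H\<close> then leaves only \<open>degree D = 0\<close>. In two variables the
  constant is a polynomial in b alone, and c is eliminated.\<close>

lemma prime_elem_bezout:
  fixes H P :: "'a::idom poly"
  assumes H: "prime_elem H" "degree H > 0" "\<not> H dvd P"
  shows "\<exists>U V d. d \<noteq> 0 \<and> U * H + V * P = [:d:]"
proof -
  define I where "I = {D. \<exists>U V. D = U * H + V * P}"
  have comb: "x - y * z \<in> I" if xz: "x \<in> I" "z \<in> I" for x y z
  proof -
    obtain U V U' V' where "x = U * H + V * P" "z = U' * H + V' * P"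
      using xz unfolding I_def by blast
    then have "x - y * z = (U - y * U') * H + (V - y * V') * P" by (simp add: algebra_simps)
    then show ?thesis unfolding I_def by blast
  qed
  have smul: "smult k x \<in> I" if x: "x \<in> I" for x k
  proof -
    obtain U V where "x = U * H + V * P" using x unfolding I_def by blast
    then have "smult k x = smult k U * H + smult k V * P" by (simp add: smult_add_right)
    then show ?thesis unfolding I_def by blast
  qed
  have HI: "H \<in> I" unfolding I_def by (rule CollectI, rule exI[of _ 1], rule exI[of _ 0]) simp
  have PI: "P \<in> I" unfolding I_def by (rule CollectI, rule exI[of _ 0], rule exI[of _ 1]) simp
  have H0: "H \<noteq> 0" using H(2) by auto
  obtain D where D: "D \<in> I" "D \<noteq> 0" and min: "\<And>D'. D' \<in> I \<Longrightarrow> D' \<noteq> 0 \<Longrightarrow> degree D \<le> degree D'"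
    using ex_has_least_nat[of "\<lambda>D. D \<in> I \<and> D \<noteq> 0" H degree] HI H0 by blast
  have pdiv: "\<exists>k q. k \<noteq> 0 \<and> smult k F = D * q" if "F \<in> I" for F
  proof -
    obtain q r where qr: "pseudo_divmod F D = (q, r)" by fastforce
    let ?k = "coeff D (degree D) ^ (Suc (degree F) - degree D)"
    from pseudo_divmod[OF D(2) qr]
    have e: "smult ?k F = D * q + r" and r: "r = 0 \<or> degree r < degree D" by auto
    have "r = smult ?k F - q * D" using e by simp
    then have "r \<in> I" using comb[OF smul[OF that] D(1)] by simp
    then have "r = 0" using min r by (meson leD)
    then show ?thesis using e D(2) by (intro exI[of _ ?k] exI[of _ q]) simp
  qed
  have notconst: "\<not> H dvd [:k:]" if "k \<noteq> 0" for k
    using dvd_imp_degree_le[of H "[:k:]"] that H(2) by auto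
  have "degree D = 0"
  proof (rule ccontr)
    assume deg: "degree D \<noteq> 0"
    obtain k q where kq: "k \<noteq> 0" "smult k H = D * q" using pdiv[OF HI] by blast
    have "H dvd D * q" using kq(2) by (metis dvd_smult dvd_refl)
    then have "H dvd D \<or> H dvd q" using H(1) by (simp add: prime_elem_dvd_mult_iff)
    \<comment> \<open>If \<open>H\<close> divides \<open>D\<close>, it divides a nonzero constant
      times \<open>P\<close>; if it divides the cofactor \<open>q\<close>, cancelling it leaves
      \<open>D\<close> as a factor of a constant.\<close>
    then show False
    proof
      assume HD: "H dvd D"
      obtain k' q' where k': "k' \<noteq> 0" "smult k' P = D * q'" using pdiv[OF PI] by blast
      have "H dvd [:k':] * P" using HD k'(2) by simp
      then show False using H(1,3) notconst[OF k'(1)] by (simp add: prime_elem_dvd_mult_iff del: mult_pCons_left)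
    next
      assume "H dvd q"
      then obtain q' where q': "q = H * q'" by (auto simp: dvd_def)
      have "H * (D * q') = H * [:k:]" using kq(2) q' by (simp add: algebra_simps)
      then have eq: "D * q' = [:k:]" using H0 by (metis mult_left_cancel)
      then have "degree D + degree q' = 0" using kq(1) by (metis degree_mult_eq degree_pCons_0 mult_eq_0_iff pCons_eq_0_iff)
      then show False using deg by simp
    qed
  qed
  then obtain d where d: "D = [:d:]" by (metis degree_eq_zeroE)
  obtain U V where "D = U * H + V * P" using D(1) unfolding I_def by blast
  then show ?thesis using d D(2) by force
qed

text \<open>The target is a domain, so the kernel is a prime ideal and contains a prime factor of
  \<open>x\<close>. This picks the component through a given point or branch.\<close>

lemma prime_elem_factor_in_kernel:
  fixes f :: "'a::{factorial_semiring, comm_ring_1} \<Rightarrow> 'b::idom"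
  assumes f: "ring_hom_fun f" and x: "x \<noteq> 0" "f x = 0"
  shows "\<exists>p. prime_elem p \<and> p dvd x \<and> f p = 0"
  using x
proof (induction x rule: prime_divisors_induct)
  case (unit x)
  then have "f x dvd 1" using ring_hom_fun_dvd[OF f, of x 1] ring_hom_funD(2)[OF f] by simp
  with unit show ?case by simp
next
  case (factor p x)
  then have "f p = 0 \<or> f x = 0" "x \<noteq> 0" by (auto simp: ring_hom_funD[OF f])
  with factor show ?case by (meson dvd_mult dvd_triv_left prime_imp_prime_elem)
qed auto

text \<open>Otherwise elimination leaves a nonzero \<open>d\<close> in b alone that vanishes at
  every common zero. For b off the roots of \<open>d\<close> and of the leading coefficient of
  \<open>H\<close>, there is still a zero c of \<open>H\<close>.\<close>

lemma nullstellensatz_curve: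
  fixes H P :: "complex poly poly"
  assumes H: "prime_elem H" "degree H > 0"
    and van: "\<And>b c. ev H b c = 0 \<Longrightarrow> ev P b c = 0"
  shows "H dvd P"
proof (rule ccontr)
  assume "\<not> H dvd P"
  from prime_elem_bezout[OF H this] obtain U V d where d: "d \<noteq> 0" "U * H + V * P = [:d:]" by blast
  define r where "r = d * lead_coeff H"
  have "r \<noteq> 0" using d H(2) by (auto simp: r_def)
  then have "finite {b. poly r b = 0}" by (rule poly_roots_finite)
  then obtain b where b: "poly r b \<noteq> 0"
    by (metis (mono_tags, lifting) UNIV_eq_I infinite_UNIV_char_0 mem_Collect_eq)
  have "degree (map_poly (\<lambda>p. poly p b) H) = degree H"
    using b by (intro map_poly_degree_eq) (simp add: r_def)
  then obtain c where "ev H b c = 0"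
    using fundamental_theorem_of_algebra[of "map_poly (\<lambda>p. poly p b) H"] H(2)
    by (auto simp: ev_eq constant_degree)
  moreover from this have "ev P b c = 0" by (rule van)
  ultimately have "ev [:d:] b c = 0" unfolding d(2)[symmetric] by (simp add: ev_simps)
  then show False using b by (simp add: ev_eq map_poly_pCons r_def)
qed

text \<open>
  The \<open>k\<close>-th iterate of 0 under \<open>1 + b / z + c / z\<^sup>2\<close> is \<open>A\<^sub>k / A\<^bsub>k - 1\<^esub>\<^sup>2\<close> for
  \<open>A\<^sub>k = orb_num b c k\<close>, \<open>k > 0\<close>.
\<close>

fun orb_num :: "'a::comm_ring_1 \<Rightarrow> 'a \<Rightarrow> nat \<Rightarrow> 'a" where
  "orb_num b c 0 = 0"
| "orb_num b c (Suc 0) = 1"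
| "orb_num b c (Suc (Suc k)) =
     (orb_num b c (Suc k))\<^sup>2 + b * orb_num b c (Suc k) * (orb_num b c k)\<^sup>2 + c * (orb_num b c k) ^ 4"

lemma hom_orb_num: "ring_hom_fun h \<Longrightarrow> h (orb_num b c k) = orb_num (h b) (h c) k"
  by (induction b c k rule: orb_num.induct) (auto simp: ring_hom_funD ring_hom_fun_power)

section \<open>Divisibility among the orbit numerators\<close>

lemma dvd_diff_mult:
  fixes d :: "'a::comm_ring_1"
  assumes "d dvd x - x'" "d dvd y - y'"
  shows "d dvd x * y - x' * y'"
proof -
  have "x * y - x' * y' = x * (y - y') + (x - x') * y'" by (simp add: algebra_simps)
  then show ?thesis using assms by simp
qed

lemma dvd_diff_power:
  fixes d :: "'a::comm_ring_1"
  shows "d dvd x - x' \<Longrightarrow> d dvd x ^ k - x' ^ k"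
  by (induction k) (auto intro: dvd_diff_mult)

lemma dvd_diff_add:
  fixes d :: "'a::comm_ring_1"
  assumes "d dvd x - x'" "d dvd y - y'"
  shows "d dvd (x + y) - (x' + y')"
  using dvd_add[OF assms] by (simp add: algebra_simps)

text \<open>Modulo \<open>A\<^sub>m\<close> the sequence restarts, with 0 followed by
  \<open>u m\<close>. The recursion turns factors \<open>U\<close> and \<open>U\<^sup>2\<close> of
  two consecutive terms into \<open>U ^ 4\<close> on the next, so the restarted sequence is the
  original one up to powers of \<open>u m\<close>.\<close>

lemma orb_num_shift:
  fixes b c :: "'a::comm_ring_1"
  defines "u \<equiv> \<lambda>m. orb_num b c (Suc m)"
  shows "orb_num b c m dvd orb_num b c (m + Suc j) - u m ^ (2 ^ j) * orb_num b c (Suc j)"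
proof (induction j rule: less_induct)
  case (less j)
  let ?A = "orb_num b c"
  consider "j = 0" | "j = 1" | i where "j = Suc (Suc i)" by (metis One_nat_def not0_implies_Suc)
  then show ?case
  proof cases
    case 1 then show ?thesis by (simp add: u_def)
  next
    case 2
    have "?A (m + Suc j) - u m ^ (2 ^ j) * ?A (Suc j) = ?A m * (b * ?A (Suc m) * ?A m + c * ?A m ^ 3)"
      by (simp add: 2 u_def algebra_simps power2_eq_square power3_eq_cube power4_eq_xxxx)
    then show ?thesis by simp
  next
    case 3
    define U where "U = u m ^ (2 ^ i)"
    have U: "u m ^ (2 ^ Suc i) = U ^ 2" "u m ^ (2 ^ j) = U ^ 4"
      by (simp_all add: U_def 3 power_mult[symmetric] mult.commute)
    have i: "?A m dvd ?A (m + Suc i) - U * ?A (Suc i)" using less[of i] 3 by (simp add: U_def)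
    have si: "?A m dvd ?A (m + Suc (Suc i)) - U\<^sup>2 * ?A (Suc (Suc i))"
      using less[of "Suc i"] unfolding U(1) by (simp add: 3)
    have "?A (m + Suc j) = (?A (m + Suc (Suc i)))\<^sup>2 + b * ?A (m + Suc (Suc i)) * (?A (m + Suc i))\<^sup>2
        + c * (?A (m + Suc i)) ^ 4" by (simp add: 3)
    moreover have "U ^ 4 * ?A (Suc j) = (U\<^sup>2 * ?A (Suc (Suc i)))\<^sup>2
        + b * (U\<^sup>2 * ?A (Suc (Suc i))) * (U * ?A (Suc i))\<^sup>2 + c * (U * ?A (Suc i)) ^ 4"
      unfolding 3 orb_num.simps(3)[of b c "Suc i"]
      by (simp add: algebra_simps power_mult_distrib power2_eq_square power4_eq_xxxx)
    ultimately show ?thesis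
      unfolding U(2) by (simp only:) (intro dvd_diff_add dvd_diff_mult dvd_diff_power i si; simp)
  qed
qed

lemma orb_num_dvd: "orb_num b c m dvd orb_num b c (m * j)"
proof (induction j)
  case (Suc j)
  show ?case
  proof (cases "m * j")
    case 0
    then show ?thesis by (cases "m = 0") auto
  next
    case (Suc i)
    have "orb_num b c m dvd orb_num b c (m + Suc i) - orb_num b c (Suc m) ^ (2 ^ i) * orb_num b c (Suc i)"
      by (rule orb_num_shift)
    with Suc.IH Suc show ?thesis by (simp add: dvd_diff_left_iff)
  qed
qed auto

subsection \<open>Polynomial maps\<close>

definition crit_orbit :: "'a::comm_ring_1 \<Rightarrow> nat \<Rightarrow> 'a" where
  "crit_orbit C k = ((\<lambda>z. z\<^sup>2 + C) ^^ k) 0"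

lemma crit_orbit_simps [simp]:
  "crit_orbit C 0 = 0" "crit_orbit C (Suc k) = (crit_orbit C k)\<^sup>2 + C"
  by (simp_all add: crit_orbit_def)

lemma hom_crit_orbit: "ring_hom_fun h \<Longrightarrow> h (crit_orbit C k) = crit_orbit (h C) k"
  by (induction k) (simp_all add: ring_hom_funD ring_hom_fun_power)

lemma ring_hom_fun_of_int: "ring_hom_fun (of_int :: int \<Rightarrow> 'a::comm_ring_1)"
  by (simp add: ring_hom_fun_def)

lemma crit_orbit_monic:
  "degree (crit_orbit [:0, 1::int:] (Suc k)) > 0 \<and> lead_coeff (crit_orbit [:0, 1::int:] (Suc k)) = 1"
proof (induction k)
  case (Suc k)
  let ?P = "crit_orbit [:0, 1::int:] (Suc k)"
  have "?P \<noteq> 0" using Suc.IH by (metis degree_0 less_numeral_extra(3))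
  then have deg: "degree (?P\<^sup>2) = 2 * degree ?P" by (rule degree_power_eq)
  have "degree [:0, 1::int:] < degree (?P\<^sup>2)"
    unfolding deg using Suc.IH by (simp del: crit_orbit_simps)
  then have "degree ([:0, 1::int:] + ?P\<^sup>2) = degree (?P\<^sup>2)" "lead_coeff ([:0, 1::int:] + ?P\<^sup>2) = lead_coeff (?P\<^sup>2)"
    by (rule degree_add_eq_right, rule lead_coeff_add_le)
  moreover have "lead_coeff (?P\<^sup>2) = 1" using Suc.IH by (simp add: lead_coeff_power del: crit_orbit_simps)
  moreover have "degree (?P\<^sup>2) > 0" unfolding deg using Suc.IH by (simp del: crit_orbit_simps)
  ultimately show ?case by (simp add: add.commute)
qed simp

text \<open>The square contributes an even derivative and the added variable contributes 1.\<close>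

lemma pderiv_crit_orbit: "\<exists>K. pderiv (crit_orbit [:0, 1::int:] (Suc k)) = 1 + 2 * K"
  by (rule exI[of _ "crit_orbit [:0, 1:] k * pderiv (crit_orbit [:0, 1:] k)"])
     (simp add: pderiv_add power2_eq_square pderiv_mult pderiv_pCons one_pCons algebra_simps)

lemma pderiv_map_poly_of_int:
  "pderiv (map_poly of_int p :: complex poly) = map_poly of_int (pderiv p)"
  by (rule poly_eqI) (simp add: coeff_pderiv coeff_map_poly)

text \<open>
  A common root of the \<open>n\<close>-th polynomial \<open>P\<close> and its derivative is a root of a prime factor
  \<open>M\<close> of \<open>P\<close> over the integers, which also divides \<open>P'\<close>.  But \<open>M\<close> is monic up to sign,
  and \<open>P' = 1\<close> modulo 2.
\<close>

lemma crit_orbit_simple_root: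
  fixes C :: complex
  assumes n: "n > 0" and root: "crit_orbit C n = 0"
  obtains D where "((\<lambda>z. crit_orbit z n) has_field_derivative D) (at C)" "D \<noteq> 0"
proof -
  define P :: "int poly" where "P = crit_orbit [:0, 1:] n"
  define f :: "int poly \<Rightarrow> complex" where "f = (\<lambda>p. poly (map_poly of_int p) C)"
  have f: "ring_hom_fun f"
    unfolding f_def by (rule ring_hom_fun_poly_map[OF ring_hom_fun_of_int])
  have Pz: "poly (map_poly of_int P) z = crit_orbit z n" for z :: complex
    unfolding P_def hom_crit_orbit[OF ring_hom_fun_poly_map[OF ring_hom_fun_of_int]]
    by (simp add: map_poly_pCons)
  have monic: "degree P > 0" "lead_coeff P = 1"
    using crit_orbit_monic[of "n - 1"] n by (simp_all add: P_def del: crit_orbit_simps)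
  obtain K where K: "pderiv P = 1 + 2 * K"
    using pderiv_crit_orbit[of "n - 1"] n by (auto simp add: P_def simp del: crit_orbit_simps)
  have "f (pderiv P) \<noteq> 0"
  proof
    assume dz: "f (pderiv P) = 0"
    have "f P = 0" using root Pz[of C] by (simp add: f_def)
    then obtain M where M: "prime_elem M" "M dvd P" "f M = 0"
      using prime_elem_factor_in_kernel[OF f, of P] monic by fastforce
    have const: "f [:d:] = of_int d" for d by (simp add: f_def map_poly_pCons)
    have degM: "degree M > 0"
    proof (rule ccontr)
      assume "\<not> degree M > 0"
      then obtain m where m: "M = [:m:]" by (meson degree_eq_zeroE gr0I)
      with M const[of m] show False by auto
    qed
    have "M dvd pderiv P"
    proof (rule ccontr)
      assume "\<not> M dvd pderiv P"
      then obtain U V d where "d \<noteq> 0" "U * M + V * pderiv P = [:d:]"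
        using prime_elem_bezout[OF M(1) degM] by blast
      moreover from this have "f [:d:] = f U * f M + f V * f (pderiv P)"
        by (metis ring_hom_funD(3,4)[OF f])
      ultimately show False using M(3) dz const[of d] by simp
    qed
    then obtain R where R: "pderiv P = M * R" by (auto simp: dvd_def)
    let ?h = "map_poly of_int :: int poly \<Rightarrow> bit poly"
    have h: "ring_hom_fun ?h" by (rule ring_hom_fun_map_poly[OF ring_hom_fun_of_int])
    have "?h M * ?h R = ?h (pderiv P)" using R by (simp add: ring_hom_funD(4)[OF h])
    also have "\<dots> = 1 + (1 + 1) * ?h K"
      unfolding K using ring_hom_funD(3,4)[OF h] ring_hom_funD(2)[OF h] by (metis one_add_one)
    also have "(1 + 1 :: bit poly) = 0" by (simp add: one_pCons)
    finally have "?h M dvd 1" by (metis add.right_neutral dvd_triv_left mult_zero_left)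
    then have "degree (?h M) = 0" by (metis is_unit_iff_degree not_is_unit_0)
    \<comment> \<open>A factor of a monic integer polynomial has leading coefficient 1 or -1, so
      reduction modulo 2 preserves the degree of \<open>M\<close>, although the image is a
      unit.\<close>
    moreover have "lead_coeff M dvd 1" using M(2) monic(2) by (metis dvd_def lead_coeff_mult)
    then have "odd (lead_coeff M)" by (metis dvd_trans odd_one)
    then obtain m where m: "lead_coeff M = 2 * m + 1" by (elim oddE)
    have "(of_int (lead_coeff M) :: bit) = 1" unfolding m by simp
    then have "degree (?h M) = degree M" by (intro map_poly_degree_eq) simp
    ultimately show False using degM by simp
  qed
  moreover have "((\<lambda>z. poly (map_poly of_int P) z) has_field_derivative f (pderiv P)) (at C)"
    using poly_DERIV[of "map_poly of_int P" C] by (simp add: f_def pderiv_map_poly_of_int)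
  ultimately show ?thesis using that[of "f (pderiv P)"] by (simp add: Pz)
qed

section \<open>The curve of polynomial maps in the parameter plane\<close>

text \<open>For \<open>C\<close> other than 0 and -1, these are the parameters at which the second
  critical point \<open>- 2 * c / b = C / (1 + C)\<close> of
  \<open>1 + b / z + c / z\<^sup>2\<close> is fixed, which makes the map conjugate to a
  polynomial.\<close>

definition poly_b :: "complex \<Rightarrow> complex" where "poly_b C = - 2 * C / (1 + C)\<^sup>2"
definition poly_c :: "complex \<Rightarrow> complex" where "poly_c C = C\<^sup>2 / (1 + C) ^ 3"

text \<open>One step of the induction for \<open>orb_num_poly\<close>: \<open>y\<close> stands for a
  squared critical iterate and \<open>E\<close> for the denominator reached, so that the field
  computation has only three unknowns.\<close>

lemma orb_num_poly_step:
  fixes C E y :: "'a::field_char_0"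
  assumes "C \<noteq> 0" "1 + C \<noteq> 0" "E \<noteq> 0"
  shows "((y + C) / E)\<^sup>2 + - 2 * C / (1 + C)\<^sup>2 * ((y + C) / E) * (y * (1 + C) / (E * C)) +
      C\<^sup>2 / (1 + C) ^ 3 * (y * (1 + C) / (E * C))\<^sup>2 = ((y + C)\<^sup>2 + C) / (E\<^sup>2 * (1 + C) / C)"
  using assms by (simp add: divide_simps) (simp add: algebra_simps power2_eq_square power3_eq_cube)

text \<open>
  The coordinate change \<open>y = C z / (z - w)\<close>, \<open>w = C / (1 + C)\<close>, conjugates
  \<open>1 + b / z + c / z\<^sup>2\<close> at these parameters to \<open>y\<^sup>2 + C\<close>.
\<close>

lemma orb_num_poly:
  assumes C: "C \<noteq> 0" "1 + C \<noteq> 0"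
  shows "orb_num (poly_b C) (poly_c C) (Suc j) = crit_orbit C (Suc j) / (C * (1 + C) ^ (2 ^ j - 1))"
proof -
  define e where "e j = C * (1 + C) ^ (2 ^ j - 1)" for j :: nat
  have e_nz: "e j \<noteq> 0" for j using C by (simp add: e_def)
  have e_Suc: "e (Suc j) = (e j)\<^sup>2 * (1 + C) / C" for j
  proof -
    have "(2::nat) ^ j \<ge> 1" by simp
    then have "2 ^ Suc j - 1 = Suc ((2 ^ j - 1) + (2 ^ j - 1 :: nat))" unfolding power_Suc by arith
    then have "(1 + C) ^ (2 ^ Suc j - 1) = (1 + C) * ((1 + C) ^ (2 ^ j - 1) * (1 + C) ^ (2 ^ j - 1))"
      by (simp only: power_Suc power_add)
    then show ?thesis using C unfolding e_def by (simp add: power2_eq_square)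
  qed
  have "orb_num (poly_b C) (poly_c C) (Suc j) = crit_orbit C (Suc j) / e j"
  proof (induction j rule: less_induct)
    case (less j)
    consider "j = 0" | "j = 1" | i where "j = Suc (Suc i)" by (metis One_nat_def not0_implies_Suc)
    then show ?case
    proof cases
      case 1 then show ?thesis using C by (simp add: e_def)
    next
      case 2
      have "C\<^sup>2 + C = C * (1 + C)" by (simp add: algebra_simps power2_eq_square)
      then show ?thesis using C 2 by (simp add: e_def)
    next
      case 3
      define y E where "y = (crit_orbit C (Suc i))\<^sup>2" and "E = e (Suc i)"
      have E: "E \<noteq> 0" using e_nz by (simp add: E_def)
      have ei: "(e i)\<^sup>2 = E * C / (1 + C)" using C by (simp add: E_def e_Suc)
      have a: "(orb_num (poly_b C) (poly_c C) (Suc i))\<^sup>2 = y * (1 + C) / (E * C)"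
        using less[of i] 3 C ei by (simp add: power_divide y_def)
      have a4: "(orb_num (poly_b C) (poly_c C) (Suc i)) ^ 4 = (y * (1 + C) / (E * C))\<^sup>2"
        unfolding a[symmetric] by (simp add: power_mult[symmetric])
      have b: "orb_num (poly_b C) (poly_c C) (Suc (Suc i)) = (y + C) / E"
        using less[of "Suc i"] 3 by (simp only: E_def y_def crit_orbit_simps(2)[of C "Suc i"])
      have ej: "e j = E\<^sup>2 * (1 + C) / C" by (simp add: 3 E_def e_Suc)
      have "((y + C) / E)\<^sup>2 + poly_b C * ((y + C) / E) * (y * (1 + C) / (E * C)) + poly_c C * (y * (1 + C) / (E * C))\<^sup>2
          = ((y + C)\<^sup>2 + C) / (E\<^sup>2 * (1 + C) / C)"
        unfolding poly_b_def poly_c_def by (rule orb_num_poly_step[OF C E])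
      moreover have "crit_orbit C (Suc j) = (y + C)\<^sup>2 + C" by (simp add: 3 y_def)
      ultimately show ?thesis by (simp only: 3 ej[unfolded 3] orb_num.simps(3)[of _ _ "Suc i"] a a4 b)
    qed
  qed
  then show ?thesis by (simp add: e_def)
qed

lemma orb_num_poly_eq_0_iff:
  assumes "C \<noteq> 0" "1 + C \<noteq> 0" "n > 0"
  shows "orb_num (poly_b C) (poly_c C) n = 0 \<longleftrightarrow> crit_orbit C n = 0"
  using orb_num_poly[OF assms(1,2), of "n - 1"] assms by simp

lemma field_differentiable_ev:
  assumes "f field_differentiable at z" "g field_differentiable at z"
  shows "(\<lambda>z. ev P (f z) (g z)) field_differentiable at z"
proof (induction P)
  case (pCons p P)
  have "(\<lambda>z. poly p (f z)) field_differentiable at z"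
    by (induction p) (auto intro!: field_differentiable_add field_differentiable_mult assms)
  then show ?case using pCons assms
    by (auto simp: eval2_pCons[OF ring_hom_fun_id] intro!: field_differentiable_add field_differentiable_mult)
qed simp

definition gen_orb :: "nat \<Rightarrow> complex poly poly" where
  "gen_orb = orb_num [:[:0, 1:]:] [:0, 1:]"

lemma eval2_gen_orb: "ring_hom_fun h \<Longrightarrow> eval2 h \<beta> \<gamma> (gen_orb k) = orb_num \<beta> \<gamma> k"
  by (simp add: gen_orb_def hom_orb_num[OF ring_hom_fun_eval2] eval2_vars)

lemmas ev_gen_orb = eval2_gen_orb[OF ring_hom_fun_id]

text \<open>Up to a nonvanishing factor, \<open>gen_orb n\<close> restricts to
  \<open>crit_orbit z n\<close> on the curve of polynomial maps. Two factors vanishing at one point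
  would give this function derivative zero there, against the simplicity of its roots.\<close>

lemma gen_orb_simple_on_polys:
  assumes C: "C \<noteq> 0" "1 + C \<noteq> 0" and n: "n > 0" and dvd: "P * R dvd gen_orb n"
    and P: "ev P (poly_b C) (poly_c C) = 0" and R: "ev R (poly_b C) (poly_c C) = 0"
  shows False
proof -
  obtain K where K: "gen_orb n = P * R * K" using dvd by (auto simp: dvd_def)
  define e where "e z = z * (1 + z) ^ (2 ^ (n - 1) - 1)" for z :: complex
  define F where "F Q z = ev Q (poly_b z) (poly_c z)" for Q z
  have Fd: "F Q field_differentiable at C" for Q
    unfolding F_def poly_b_def poly_c_def
    by (rule field_differentiable_ev) (use C in \<open>auto intro!: derivative_intros field_differentiable_divide field_differentiable_mult field_differentiable_add field_differentiable_power field_differentiable_minus\<close>)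
  obtain P' R' K' where d: "(F P has_field_derivative P') (at C)" "(F R has_field_derivative R') (at C)"
    "((\<lambda>z. F K z * e z) has_field_derivative K') (at C)"
  proof -
    have "(\<lambda>z. F K z * e z) field_differentiable at C" unfolding e_def
      by (intro field_differentiable_mult Fd field_differentiable_power field_differentiable_add) auto
    then show ?thesis using that Fd unfolding field_differentiable_def by blast
  qed
  have "((\<lambda>z. F P z * F R z * (F K z * e z)) has_field_derivative 0) (at C)"
    using DERIV_mult[OF DERIV_mult[OF d(1,2)] d(3)] P R by (simp add: F_def)
  moreover have "eventually (\<lambda>z. z \<in> - {0, -1::complex}) (nhds C)"
    using C by (intro eventually_nhds_in_open) (auto simp: open_Compl add_eq_0_iff)
  then have "eventually (\<lambda>z. F P z * F R z * (F K z * e z) = crit_orbit z n) (nhds C)"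
  proof eventually_elim
    case (elim z)
    then have z: "z \<noteq> 0" "1 + z \<noteq> 0" by (auto simp: add_eq_0_iff)
    then have "e z \<noteq> 0" by (simp add: e_def)
    moreover have "F P z * F R z * F K z = orb_num (poly_b z) (poly_c z) n"
      unfolding F_def ev_gen_orb[symmetric] K by (simp add: ev_simps)
    moreover have "\<dots> = crit_orbit z n / e z"
      using orb_num_poly[OF z, of "n - 1"] n by (simp add: e_def)
    ultimately show ?case by (simp add: field_simps)
  qed
  ultimately have "((\<lambda>z. crit_orbit z n) has_field_derivative 0) (at C)"
    by (metis DERIV_cong_ev)
  moreover have "crit_orbit C n = 0"
    using orb_num_poly_eq_0_iff[OF C n] P ev_gen_orb[of "poly_b C" "poly_c C" n] K by (simp add: ev_simps)
  ultimately show False using crit_orbit_simple_root[OF n] DERIV_unique by metis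
qed

subsection \<open>Components meet the curve of polynomial maps\<close>

text \<open>For fixed b, the polynomial c P(b, c) vanishes for all c, c = 0 included, so every
  coefficient of \<open>P\<close> vanishes at every b.\<close>

lemma ev_eq_0_imp_0:
  assumes "\<And>b c. c \<noteq> 0 \<Longrightarrow> ev P b c = 0"
  shows "P = 0"
proof -
  have coeff0: "poly (coeff P i) b = 0" for i b
  proof -
    let ?q = "map_poly (\<lambda>p. poly p b) P"
    have "[:0, 1:] * ?q = 0"
    proof (rule ccontr)
      assume "[:0, 1:] * ?q \<noteq> 0"
      then have "finite {c. poly ([:0, 1:] * ?q) c = 0}" by (rule poly_roots_finite)
      moreover have "{c. poly ([:0, 1:] * ?q) c = 0} = UNIV" using assms by (auto simp: ev_eq)
      ultimately show False by (metis infinite_UNIV_char_0)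
    qed
    then have "coeff ?q i = 0" by simp
    then show ?thesis by (simp add: coeff_map_poly)
  qed
  show ?thesis by (rule poly_eqI) (simp add: coeff0 poly_all_0_iff_0[symmetric])
qed

lemma orb_num_0_0: "orb_num 0 0 (Suc k) = 1"
  by (induction k) auto

lemma ring_hom_fun_const: "ring_hom_fun (\<lambda>x. [:x:])"
  by (simp add: ring_hom_fun_def one_pCons)

text \<open>With d the degree of \<open>a\<close>, the summands have degree at most 4d, at most 4d +
  2 and exactly 4d + 3, so the last one dominates.\<close>

lemma degree_orb_num_step:
  fixes a a' \<beta> \<gamma> :: "'a::{idom,algebraic_semidom} poly"
  assumes deg: "degree a' = 2 * degree a" and la: "is_unit (lead_coeff a)"
    and \<beta>: "degree \<beta> \<le> 2" and \<gamma>: "degree \<gamma> = 3" "is_unit (lead_coeff \<gamma>)"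
  defines "a'' \<equiv> a'\<^sup>2 + \<beta> * a' * a\<^sup>2 + \<gamma> * a ^ 4"
  shows "degree a'' = 4 * degree a + 3" "is_unit (lead_coeff a'')"
proof -
  have nz: "a \<noteq> 0" "\<gamma> \<noteq> 0" using la \<gamma> by auto
  have d: "degree (\<gamma> * a ^ 4) = 4 * degree a + 3"
    using nz \<gamma> by (simp add: degree_mult_eq degree_power_eq)
  have "degree (a'\<^sup>2) \<le> 4 * degree a" using degree_power_le[of a' 2] deg by simp
  moreover have "degree (\<beta> * a' * a\<^sup>2) \<le> 2 + 2 * degree a + 2 * degree a"
    using degree_mult_le[of "\<beta> * a'" "a\<^sup>2"] degree_mult_le[of \<beta> a'] degree_power_le[of a 2] deg \<beta> by linarith
  ultimately have less: "degree (a'\<^sup>2 + \<beta> * a' * a\<^sup>2) < degree (\<gamma> * a ^ 4)"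
    unfolding d by (intro le_less_trans[OF degree_add_le_max]) auto
  show "degree a'' = 4 * degree a + 3"
    unfolding a''_def degree_add_eq_right[OF less] by (rule d)
  show "is_unit (lead_coeff a'')"
    unfolding a''_def lead_coeff_add_le[OF less] lead_coeff_mult lead_coeff_power
    using la \<gamma>(2) by (simp only: is_unit_mult_iff is_unit_power_iff) simp
qed

text \<open>The complementary case: the square has degree 4d + 6, the other summands at most 4d + 5
  and 4d + 3.\<close>

lemma degree_orb_num_step':
  fixes a a' \<beta> \<gamma> :: "'a::{idom,algebraic_semidom} poly"
  assumes deg: "degree a' = 2 * degree a + 3" and la: "is_unit (lead_coeff a')"
    and \<beta>: "degree \<beta> \<le> 2" and \<gamma>: "degree \<gamma> = 3" 
  defines "a'' \<equiv> a'\<^sup>2 + \<beta> * a' * a\<^sup>2 + \<gamma> * a ^ 4"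
  shows "degree a'' = 2 * degree a'" "is_unit (lead_coeff a'')"
proof -
  have d: "degree (a'\<^sup>2) = 2 * degree a'"
    using la by (intro degree_power_eq) auto
  have "degree (\<gamma> * a ^ 4) \<le> 3 + 4 * degree a" 
    using degree_mult_le[of \<gamma> "a ^ 4"] degree_power_le[of a 4] \<gamma> by simp
  moreover have "degree (\<beta> * a' * a\<^sup>2) \<le> 2 + degree a' + 2 * degree a"
    using degree_mult_le[of "\<beta> * a'" "a\<^sup>2"] degree_mult_le[of \<beta> a'] degree_power_le[of a 2] \<beta> by linarith
  ultimately have less: "degree (\<beta> * a' * a\<^sup>2 + \<gamma> * a ^ 4) < degree (a'\<^sup>2)"
    unfolding d deg by (intro le_less_trans[OF degree_add_le_max]) auto
  have eq: "a'' = (\<beta> * a' * a\<^sup>2 + \<gamma> * a ^ 4) + a'\<^sup>2" by (simp add: a''_def)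
  show "degree a'' = 2 * degree a'"
    unfolding eq degree_add_eq_right[OF less] by (rule d)
  show "is_unit (lead_coeff a'')"
    unfolding eq lead_coeff_add_le[OF less] lead_coeff_power
    using la by (simp add: is_unit_power_iff)
qed

text \<open>With weight 2 for \<open>b\<close> and 3 for \<open>c\<close>, the leading form is a power of \<open>c\<close>.\<close>

lemma lead_coeff_orb_num:
  fixes \<beta> \<gamma> :: "'a::{idom,algebraic_semidom} poly"
  assumes \<beta>: "degree \<beta> \<le> 2" and \<gamma>: "degree \<gamma> = 3" "is_unit (lead_coeff \<gamma>)"
  shows "k > 0 \<Longrightarrow> is_unit (lead_coeff (orb_num \<beta> \<gamma> k))"
proof -
  let ?A = "orb_num \<beta> \<gamma>"
  \<comment> \<open>Consecutive terms are treated in pairs because the dominating summand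
    alternates: \<open>\<gamma> * a ^ 4\<close> at odd indices from 3 on, the square at even
    ones.\<close>
  have main: "degree (?A (2 * j + 2)) = 2 * degree (?A (2 * j + 1)) \<and>
    is_unit (lead_coeff (?A (2 * j + 1))) \<and> is_unit (lead_coeff (?A (2 * j + 2)))" for j
  proof (induction j)
    case (Suc j)
    note S1 = degree_orb_num_step[OF conjunct1[OF Suc.IH] conjunct1[OF conjunct2[OF Suc.IH]] \<beta> \<gamma>]
    have e1: "?A (2 * Suc j + 1) = (?A (2 * j + 2))\<^sup>2 + \<beta> * ?A (2 * j + 2) * (?A (2 * j + 1))\<^sup>2 + \<gamma> * ?A (2 * j + 1) ^ 4"
      by simp
    have e2: "?A (2 * Suc j + 2) = (?A (2 * Suc j + 1))\<^sup>2 + \<beta> * ?A (2 * Suc j + 1) * (?A (2 * j + 2))\<^sup>2 + \<gamma> * ?A (2 * j + 2) ^ 4"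
      by simp
    have d: "degree (?A (2 * Suc j + 1)) = 2 * degree (?A (2 * j + 2)) + 3" 
      unfolding e1 S1(1) conjunct1[OF Suc.IH] by simp
    have u: "is_unit (lead_coeff (?A (2 * Suc j + 1)))" unfolding e1 by (rule S1(2))
    show ?case using degree_orb_num_step'[OF d u \<beta> \<gamma>(1)] u unfolding e2 by blast
  qed simp
  assume "k > 0"
  then have "\<exists>j. k = 2 * j + 1 \<or> k = 2 * j + 2" by presburger
  then obtain j where "k = 2 * j + 1 \<or> k = 2 * j + 2" by blast
  then show ?thesis using main[of j] by metis
qed

text \<open>A deformation: \<open>b = \<theta> * (-2 * w + 2 * w\<^sup>2)\<close>,
  \<open>c = w\<^sup>2 - w ^ 3\<close> is the curve of polynomial maps at \<theta> = 1, with
  \<open>w = C / (1 + C)\<close>. The leading coefficient of \<open>gen_orb n\<close> in w does not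
  involve \<theta>, hence neither does that of its factor \<open>H\<close>, and the degree in w
  survives at \<theta> = 1.\<close>

lemma meets_poly_curve:
  assumes H: "H dvd gen_orb n" "\<not> is_unit H" and n: "n > 0"
  obtains C where "C \<noteq> 0" "1 + C \<noteq> 0" "ev H (poly_b C) (poly_c C) = 0"
proof -
  define \<iota> :: "complex \<Rightarrow> complex poly poly" where "\<iota> = (\<lambda>x. [:[:x:]:])"
  \<comment> \<open>The outer variable is w, the inner one \<theta>.\<close>
  define \<beta> \<gamma> :: "complex poly poly" where "\<beta> = [:0, [:0, -2:], [:0, 2:]:]" and "\<gamma> = [:0, 0, 1, -1:]"
  have \<iota>: "ring_hom_fun \<iota>" unfolding \<iota>_def by (intro ring_hom_fun_comp[OF ring_hom_fun_const ring_hom_fun_const])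
  define \<psi> where "\<psi> = eval2 \<iota> \<beta> \<gamma>"
  have \<psi>: "ring_hom_fun \<psi>" unfolding \<psi>_def by (rule ring_hom_fun_eval2[OF \<iota>])
  define sp :: "complex \<Rightarrow> complex poly poly \<Rightarrow> complex poly" where "sp \<theta> = map_poly (\<lambda>p. poly p \<theta>)" for \<theta>
  have sp: "poly (sp \<theta> (\<psi> P)) w = ev P (\<theta> * (-2 * w + 2 * w\<^sup>2)) (w\<^sup>2 - w ^ 3)" for \<theta> w P
  proof -
    have "ring_hom_fun (\<lambda>p. poly (sp \<theta> p) w)"
      unfolding sp_def by (rule ring_hom_fun_poly_map[OF ring_hom_fun_poly])
    from hom_eval2[OF this \<iota>, of \<beta> \<gamma> P]
    show ?thesis
      by (simp add: \<psi>_def \<iota>_def \<beta>_def \<gamma>_def sp_def map_poly_pCons algebra_simps power2_eq_square power3_eq_cube)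
  qed
  have "lead_coeff (\<psi> H) dvd lead_coeff (\<psi> (gen_orb n))"
    using ring_hom_fun_dvd[OF \<psi> H(1)] by (metis dvd_def lead_coeff_mult)
  moreover have "is_unit (lead_coeff (\<psi> (gen_orb n)))"
    unfolding \<psi>_def eval2_gen_orb[OF \<iota>] by (rule lead_coeff_orb_num[OF _ _ _ n]) (simp_all add: \<beta>_def \<gamma>_def)
  ultimately have "is_unit (lead_coeff (\<psi> H))" by (metis dvd_trans)
  then obtain \<kappa> where \<kappa>: "lead_coeff (\<psi> H) = [:\<kappa>:]" "\<kappa> \<noteq> 0"
    by (metis is_unit_poly_iff dvd_field_iff zero_neq_one)
  have deg: "degree (sp 1 (\<psi> H)) = degree (\<psi> H)"
    unfolding sp_def using \<kappa> by (intro map_poly_degree_eq) simp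
  \<comment> \<open>As \<theta> and w vary, every (b, c) with c nonzero is reached, so degree 0
    would make \<open>H\<close> constant.\<close>
  have "degree (\<psi> H) \<noteq> 0"
  proof
    assume "degree (\<psi> H) = 0"
    then have const: "\<psi> H = [:[:\<kappa>:]:]" using \<kappa>(1) by (metis degree_eq_zeroE lead_coeff_pCons(2))
    have "H - [:[:\<kappa>:]:] = 0"
    proof (rule ev_eq_0_imp_0)
      fix b c :: complex assume c: "c \<noteq> 0"
      have "\<not> constant (poly [:- c, 0, 1, -1:])" by (simp add: constant_degree)
      then obtain w where "poly [:- c, 0, 1, -1:] w = 0" using fundamental_theorem_of_algebra by blast
      then have w: "w\<^sup>2 - w ^ 3 = c" by (simp add: algebra_simps power2_eq_square power3_eq_cube)
      have "-2 * w + 2 * w\<^sup>2 = 2 * w * (w - 1)" by (simp add: algebra_simps power2_eq_square)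
      moreover have "w \<noteq> 0" "w \<noteq> 1" using w c by auto
      ultimately have "-2 * w + 2 * w\<^sup>2 \<noteq> 0" by simp
      then have "ev H b c = \<kappa>"
        using sp[of "b / (-2 * w + 2 * w\<^sup>2)" H w] w const by (simp add: sp_def map_poly_pCons)
      then show "ev (H - [:[:\<kappa>:]:]) b c = 0"
        using ev_simps(3)[where x = "H - [:[:\<kappa>:]:]" and y = "[:[:\<kappa>:]:]"] by (simp add: ev_eq map_poly_pCons)
    qed
    then have "H = [:[:\<kappa>:]:]" by simp
    then show False using H(2) \<kappa>(2) by (simp add: is_unit_const_poly_iff dvd_field_iff)
  qed
  then obtain w where "poly (sp 1 (\<psi> H)) w = 0"
    using fundamental_theorem_of_algebra deg by (metis constant_degree)
  then have w: "ev H (-2 * w + 2 * w\<^sup>2) (w\<^sup>2 - w ^ 3) = 0" by (simp add: sp)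
  then have "ev (gen_orb n) (-2 * w + 2 * w\<^sup>2) (w\<^sup>2 - w ^ 3) = 0" using H(1) by (auto simp: dvd_def ev_simps)
  \<comment> \<open>Both excluded values give b = c = 0, where the numerator is 1.\<close>
  then have w01: "w \<noteq> 0" "w \<noteq> 1" using orb_num_0_0[of "n - 1", where 'a = complex] n by (auto simp: ev_gen_orb)
  define C where "C = w / (1 - w)"
  have C1: "1 + C = 1 / (1 - w)" using w01 by (simp add: C_def field_simps)
  have "- 2 * (w / u) / (1 / u)\<^sup>2 = - 2 * w * u" "(w / u)\<^sup>2 / (1 / u) ^ 3 = w\<^sup>2 * u" if "u \<noteq> 0" for u :: complex
    using that by (simp_all add: power2_eq_square power3_eq_cube)
  from this[of "1 - w"] have "poly_b C = -2 * w + 2 * w\<^sup>2" "poly_c C = w\<^sup>2 - w ^ 3"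
    unfolding poly_b_def poly_c_def C1 unfolding C_def using w01
    by (simp_all add: algebra_simps power2_eq_square power3_eq_cube)
  then show ?thesis using that[of C] w w01 C1 by (simp add: C_def)
qed

section \<open>Components and roots of the Gleason polynomial\<close>

definition gleason_point :: "nat \<Rightarrow> complex \<Rightarrow> bool" where
  "gleason_point n C \<longleftrightarrow> has_exact_period (\<lambda>z. z\<^sup>2 + C) n 0"

lemma gleason_point_iff:
  "gleason_point n C \<longleftrightarrow> n > 0 \<and> crit_orbit C n = 0 \<and> (\<forall>k. 0 < k \<and> k < n \<longrightarrow> crit_orbit C k \<noteq> 0)"
  by (simp add: gleason_point_def has_exact_period_def crit_orbit_def)

lemma crit_orbit_exact_period:
  assumes "n > 0" "crit_orbit C n = 0"
  obtains m where "m dvd n" "gleason_point m C"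
proof -
  let ?f = "\<lambda>z. z\<^sup>2 + C"
  define m where "m = (LEAST m. m > 0 \<and> crit_orbit C m = 0)"
  have m: "m > 0 \<and> crit_orbit C m = 0" unfolding m_def by (rule LeastI[of _ n]) (use assms in auto)
  have min: "crit_orbit C k \<noteq> 0" if "0 < k" "k < m" for k
    using not_less_Least[of k "\<lambda>m. m > 0 \<and> crit_orbit C m = 0"] that unfolding m_def by blast
  have "(?f ^^ (n mod m)) 0 = (?f ^^ n) 0"
    by (rule funpow_mod_eq) (use m in \<open>simp add: crit_orbit_def\<close>)
  then have "crit_orbit C (n mod m) = 0" using assms by (simp add: crit_orbit_def)
  then have "n mod m = 0" using min[of "n mod m"] m by force
  then show ?thesis using that[of m] m min by (auto simp: gleason_point_iff)
qed

text \<open>The meeting point with the curve of polynomial maps has an exact period m dividing n. If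
  m < n, then \<open>gen_orb m\<close> and \<open>H\<close>, which does not divide it, are two
  factors of \<open>gen_orb n\<close> vanishing at one polynomial map.\<close>

lemma meets_gleason_point:
  assumes H: "prime_elem H" "H dvd gen_orb n" and n: "n > 0"
    and ndvd: "\<And>k. 0 < k \<Longrightarrow> k < n \<Longrightarrow> \<not> H dvd gen_orb k"
  obtains C where "C \<noteq> 0" "1 + C \<noteq> 0" "gleason_point n C" "ev H (poly_b C) (poly_c C) = 0"
proof -
  have "\<not> is_unit H" using H(1) by (rule prime_elem_not_unit)
  then obtain C where C: "C \<noteq> 0" "1 + C \<noteq> 0" and HC: "ev H (poly_b C) (poly_c C) = 0"
    using meets_poly_curve[OF H(2) _ n] by blast
  then have "ev (gen_orb n) (poly_b C) (poly_c C) = 0" using H(2) by (auto simp: dvd_def ev_simps)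
  then have "crit_orbit C n = 0" by (simp add: ev_gen_orb orb_num_poly_eq_0_iff[OF C n])
  then obtain m where m: "m dvd n" "gleason_point m C" using crit_orbit_exact_period[OF n] by blast
  have "m = n"
  proof (rule ccontr)
    assume "m \<noteq> n"
    then have mn: "0 < m" "m < n" using m n by (auto simp: gleason_point_iff dest: dvd_imp_le)
    obtain Q where Q: "gen_orb n = gen_orb m * Q"
      using m(1) orb_num_dvd unfolding gen_orb_def by (metis dvd_def)
    then have "H dvd Q" using H ndvd[OF mn] by (simp add: prime_elem_dvd_mult_iff)
    then have "gen_orb m * H dvd gen_orb n" unfolding Q by (rule mult_dvd_mono[OF dvd_refl])
    moreover have "ev (gen_orb m) (poly_b C) (poly_c C) = 0"
      using m(2) mn(1) by (simp add: ev_gen_orb orb_num_poly_eq_0_iff[OF C] gleason_point_iff)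
    ultimately show False using gen_orb_simple_on_polys[OF C n] HC by blast
  qed
  then show ?thesis using that C HC m(2) by blast
qed

subsection \<open>A rational branch at infinity\<close>

text \<open>A predicate on complex series, because the branch is substituted into polynomials with
  complex coefficients.\<close>

definition rat_fps :: "complex fps \<Rightarrow> bool" where
  "rat_fps f \<longleftrightarrow> (\<forall>i. fps_nth f i \<in> \<rat>)"

lemma rat_fps_intros:
  "rat_fps 0" "rat_fps 1" "rat_fps fps_X" "rat_fps (numeral k)"
  "rat_fps f \<Longrightarrow> rat_fps g \<Longrightarrow> rat_fps (f + g)"
  "rat_fps f \<Longrightarrow> rat_fps g \<Longrightarrow> rat_fps (f - g)"
  "rat_fps f \<Longrightarrow> rat_fps g \<Longrightarrow> rat_fps (f * g)"
  by (auto simp: rat_fps_def fps_mult_nth fps_X_def numeral_fps_const intro!: Rats_add Rats_diff Rats_mult Rats_sum)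

lemma rat_fps_power: "rat_fps f \<Longrightarrow> rat_fps (f ^ k)"
  by (induction k) (auto intro: rat_fps_intros)

text \<open>Operators that do not expand the X-adic metric and preserve rationality; multiplying by
  \<open>fps_X\<close> makes them contractions.\<close>

definition admissible :: "(complex fps \<Rightarrow> complex fps) \<Rightarrow> bool" where
  "admissible E \<longleftrightarrow>
     (\<forall>x y m. (\<forall>i<m. fps_nth x i = fps_nth y i) \<longrightarrow> (\<forall>i<m. fps_nth (E x) i = fps_nth (E y) i)) \<and>
     (\<forall>x. rat_fps x \<longrightarrow> rat_fps (E x))"

lemma admissible_const: "rat_fps f \<Longrightarrow> admissible (\<lambda>x. f)"
  by (simp add: admissible_def)

lemma admissible_id: "admissible (\<lambda>x. x)"
  by (simp add: admissible_def)

lemma admissible_nth: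
  assumes "admissible E" "\<forall>i<m. fps_nth x i = fps_nth y i" "i < m"
  shows "fps_nth (E x) i = fps_nth (E y) i"
  using assms unfolding admissible_def by blast

lemma admissible_add:
  assumes "admissible E" "admissible F"
  shows "admissible (\<lambda>x. E x + F x)" "admissible (\<lambda>x. E x - F x)"
  using assms admissible_nth[OF assms(1)] admissible_nth[OF assms(2)]
  by (auto simp: admissible_def intro: rat_fps_intros)

lemma admissible_mult:
  assumes "admissible E" "admissible F"
  shows "admissible (\<lambda>x. E x * F x)"
  unfolding admissible_def
proof (intro conjI allI impI)
  fix x y :: "complex fps" and m i :: nat
  assume eq: "\<forall>i<m. fps_nth x i = fps_nth y i" and "i < m"
  then have "fps_nth (E x) j = fps_nth (E y) j" "fps_nth (F x) j = fps_nth (F y) j" if "j \<le> i" for j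
    using assms that unfolding admissible_def by (meson le_less_trans)+
  then show "fps_nth (E x * F x) i = fps_nth (E y * F y) i"
    unfolding fps_mult_nth by (intro sum.cong) auto
qed (use assms in \<open>auto simp: admissible_def intro: rat_fps_intros\<close>)

lemma admissible_power: "admissible E \<Longrightarrow> admissible (\<lambda>x. E x ^ k)"
  by (induction k) (auto intro: admissible_mult admissible_const rat_fps_intros)

lemmas admissible_intros =
  admissible_const admissible_id admissible_add admissible_mult admissible_power
  rat_fps_power rat_fps_intros

text \<open>The contraction principle in the X-adic metric: the iterates of \<open>T\<close> from 0
  stay rational, and each coefficient is eventually constant.\<close>

lemma admissible_fixpoint:
  assumes E: "admissible E"
  obtains x where "rat_fps x" "x = - 1 - fps_X * E x"
proof -
  define T where "T x = 0 - (1 + fps_X * E x)" for x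
  define s where "s k = (T ^^ k) 0" for k
  have s_Suc: "s (Suc k) = T (s k)" for k by (simp add: s_def)
  have T: "fps_nth (T x) i = fps_nth (T y) i" if "\<forall>i<m. fps_nth x i = fps_nth y i" "i < Suc m" for x y m i
    using E that unfolding T_def admissible_def by (cases i) auto
  have step: "\<forall>i<k. fps_nth (s (Suc k)) i = fps_nth (s k) i" for k
  proof (induction k)
    case (Suc k)
    then show ?case using T[of k "s (Suc k)" "s k"] by (simp add: s_Suc)
  qed simp
  have stable: "fps_nth (s (m + k)) i = fps_nth (s m) i" if "i < m" for i m k
  proof (induction k)
    case (Suc k)
    then show ?case using step[of "m + k"] that by simp
  qed simp
  have rat: "rat_fps (s k)" for k
  proof (induction k)
    case (Suc k)
    then show ?case using E unfolding s_Suc T_def admissible_def by (intro rat_fps_intros) auto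
  qed (simp add: s_def rat_fps_intros)
  \<comment> \<open>Coefficient \<open>i\<close> is final from the iterate \<open>s (Suc i)\<close>
    on.\<close>
  define x where "x = Abs_fps (\<lambda>i. fps_nth (s (Suc i)) i)"
  have x: "fps_nth x i = fps_nth (s m) i" if "i < m" for i m
    using stable[of i "Suc i" "m - Suc i"] that by (simp add: x_def)
  have "x = T x"
  proof (rule fps_ext)
    fix i
    have "fps_nth (T x) i = fps_nth (T (s i)) i" by (rule T[of i]) (use x in auto)
    then show "fps_nth x i = fps_nth (T x) i" using x[of i "Suc i"] by (simp add: s_Suc)
  qed
  moreover have "rat_fps x" using rat by (simp add: x_def rat_fps_def)
  ultimately show ?thesis using that by (simp add: T_def algebra_simps)
qed

section \<open>Expansion of the orbit along the branch\<close>

lemma fls_X_inv_times_X: "fls_X_inv * fps_to_fls (fps_X * f) = fps_to_fls (f :: 'a::comm_ring_1 fps)"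
proof -
  have "fls_X_inv * fps_to_fls (fps_X * f) = (fls_X_inv * fls_X) * fps_to_fls f"
    by (simp add: fls_times_fps_to_fls mult.assoc)
  also have "fls_X_inv * fls_X = (1 :: 'a fls)"
    by (simp add: fls_X_inv_times_conv_shift)
  finally show ?thesis by simp
qed

lemma branch_square:
  fixes X W :: "'a::comm_ring_1"
  shows "(1 + X ^ (j + 2) * W)\<^sup>2 = 1 + X * (2 * X ^ (j + 1) * W + X ^ (2 * j + 3) * W\<^sup>2)"
proof -
  define p where "p = X ^ (j + 1)"
  have "j + 2 = Suc (j + 1)" "2 * j + 3 = Suc ((j + 1) + (j + 1))" by simp_all
  then have "X ^ (j + 2) = X * p" "X ^ (2 * j + 3) = X * (p * p)"
    by (simp_all only: power_Suc power_add p_def)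
  then show ?thesis unfolding p_def[symmetric] by (simp add: algebra_simps power2_eq_square)
qed

text \<open>The computation in the inductive step of \<open>orb_num_at_infinity\<close>, with
  \<open>p\<close> for \<open>X ^ j\<close> and \<open>p1\<close>, \<open>p2\<close>,
  \<open>p3\<close>, \<open>I\<close>, \<open>XN\<close> for further powers, so that no symbolic
  exponents remain.\<close>

lemma branch_identity:
  fixes X p :: "'a::comm_ring_1"
  assumes "w2 = 1 + X * T" "V = x + X * E" "XN = I * p * X" "p1 = p * X" "p2 = p * X * X" "p3 = p * X * X * X"
  shows "(1 + p1 * V)\<^sup>2 + p * w2 * (V - 2 * X * W - p3 * W\<^sup>2) + XN * x * q =
    1 + p * (x + X * (2 * V + p1 * V\<^sup>2 + E - (2 * W + p2 * W\<^sup>2) + T * (V - 2 * X * W - p3 * W\<^sup>2) + I * x * q))"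
proof -
  define S where "S = V - 2 * X * W - p3 * W\<^sup>2"
  have V: "V = S + 2 * X * W + p * X * X * X * W\<^sup>2" by (simp add: S_def assms(6))
  have x: "x = V - X * E" by (simp add: assms(2))
  show ?thesis unfolding S_def[symmetric] assms(1,3-6) x unfolding V
    by (simp add: algebra_simps power2_eq_square)
qed

text \<open>
  Near the point at infinity where \<open>b\<close> tends to \<open>\<infinity>\<close> with \<open>b + c = 0\<close>, the orbit of 0 is
  \<open>0 \<mapsto> \<infinity> \<mapsto> 1 \<mapsto> 1\<close>, with a fixed point of multiplier about \<open>b\<close>.  Starting at distance
  \<open>t\<^bsup>n - 3\<^esup> x\<close> from it, \<open>t = 1 / b\<close>, the orbit is at distance about \<open>x\<close> after \<open>n - 3\<close>
  further steps.
\<close>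

lemma orb_num_at_infinity:
  assumes "i \<le> N"
  shows "\<exists>W E. admissible W \<and> admissible E \<and>
    (\<forall>x. let A = orb_num fls_X_inv (- fls_X_inv + fps_to_fls (fps_X ^ N * x)) in
       A (i + 2) = fps_to_fls (1 + fps_X ^ (N - i + 1) * W x) \<and>
       A (i + 3) = fps_to_fls (1 + fps_X ^ (N - i) * (x + fps_X * E x)))"
  using assms
proof (induction i)
  case 0
  have "orb_num b (- b + y) 2 = 1" "orb_num b (- b + y) 3 = 1 + y" for b y :: "complex fls"
    by (simp_all add: numeral_2_eq_2 numeral_3_eq_3)
  then show ?case
    by (intro exI[of _ "\<lambda>x. 0"] conjI) (auto intro!: admissible_intros simp: Let_def)
next
  case (Suc i)
  define j where "j = N - Suc i"
  have j: "N - i = Suc j" "N = i + Suc j" using Suc.prems by (auto simp: j_def)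
  obtain W E where W: "admissible W" and E: "admissible E" and
    IH: "\<And>x. let A = orb_num fls_X_inv (- fls_X_inv + fps_to_fls (fps_X ^ N * x)) in
       A (i + 2) = fps_to_fls (1 + fps_X ^ (Suc j + 1) * W x) \<and>
       A (i + 3) = fps_to_fls (1 + fps_X ^ Suc j * (x + fps_X * E x))"
    using Suc j by auto
  define V where "V x = x + fps_X * E x" for x
  \<comment> \<open>Everything in the next numerator beyond \<open>1 + fps_X ^ j * x\<close>,
    divided by \<open>fps_X ^ Suc j\<close>.\<close>
  define E' where "E' x = 2 * V x + fps_X ^ Suc j * (V x)\<^sup>2 + E x - (2 * W x + fps_X ^ (j + 2) * (W x)\<^sup>2)
    + (2 * fps_X ^ (j + 1) * W x + fps_X ^ (2 * j + 3) * (W x)\<^sup>2) * (V x - 2 * fps_X * W x - fps_X ^ (j + 3) * (W x)\<^sup>2)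
    + fps_X ^ i * x * (1 + fps_X ^ (j + 2) * W x) ^ 4" for x
  have V: "admissible V" unfolding V_def by (intro admissible_intros E)
  have E': "admissible E'" unfolding E'_def by (intro admissible_intros E V W)
  have "let A = orb_num fls_X_inv (- fls_X_inv + fps_to_fls (fps_X ^ N * x)) in
       A (Suc i + 2) = fps_to_fls (1 + fps_X ^ (N - Suc i + 1) * V x) \<and>
       A (Suc i + 3) = fps_to_fls (1 + fps_X ^ (N - Suc i) * (x + fps_X * E' x))" for x
  proof -
    let ?b = "fls_X_inv :: complex fls"
    let ?A = "orb_num ?b (- ?b + fps_to_fls (fps_X ^ N * x))"
    define w v where "w = 1 + fps_X ^ (j + 2) * W x" and "v = 1 + fps_X ^ Suc j * V x"
    have A: "?A (i + 2) = fps_to_fls w" "?A (i + 3) = fps_to_fls v"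
      using IH[of x] by (simp_all add: Let_def w_def v_def V_def)
    have V_eq: "?A (Suc i + 2) = fps_to_fls (1 + fps_X ^ (N - Suc i + 1) * V x)"
      using A(2) by (simp add: v_def j_def numeral_2_eq_2 numeral_3_eq_3)
    \<comment> \<open>The two terms with the pole of \<open>?b\<close> combine to \<open>?b\<close>
      times \<open>w\<^sup>2 * (v - w\<^sup>2)\<close>. As \<open>v - w\<^sup>2\<close> is divisible
      by \<open>fps_X ^ Suc j\<close>, their sum is the power series \<open>r\<close>.\<close>
    define r where "r = fps_X ^ j * w\<^sup>2 * (V x - 2 * fps_X * W x - fps_X ^ (j + 3) * (W x)\<^sup>2)"
    have r: "fps_X * r = w\<^sup>2 * (v - w\<^sup>2)"
      unfolding r_def w_def v_def by (simp add: algebra_simps power2_eq_square power_add power3_eq_cube)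
    have "?A (Suc i + 3) = (?A (i + 3))\<^sup>2 + ?b * ?A (i + 3) * (?A (i + 2))\<^sup>2
        + (- ?b + fps_to_fls (fps_X ^ N * x)) * ?A (i + 2) ^ 4"
      by (simp add: numeral_2_eq_2 numeral_3_eq_3 numeral_eq_Suc)
    also have "\<dots> = (fps_to_fls v)\<^sup>2 + ?b * fps_to_fls (w\<^sup>2 * (v - w\<^sup>2)) + fps_to_fls (fps_X ^ N * x) * fps_to_fls w ^ 4"
      unfolding A by (simp add: fls_times_fps_to_fls fps_to_fls_power algebra_simps power2_eq_square power4_eq_xxxx)
    also have "\<dots> = fps_to_fls (v\<^sup>2 + r + fps_X ^ N * x * w ^ 4)"
      unfolding r[symmetric] fls_X_inv_times_X by (simp add: fls_times_fps_to_fls fps_to_fls_power)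
    also have "v\<^sup>2 + r + fps_X ^ N * x * w ^ 4 = 1 + fps_X ^ j * (x + fps_X * E' x)"
    proof -
      have e1: "w\<^sup>2 = 1 + fps_X * (2 * fps_X ^ (j + 1) * W x + fps_X ^ (2 * j + 3) * (W x)\<^sup>2)"
        unfolding w_def by (rule branch_square)
      have e2: "fps_X ^ N = fps_X ^ i * fps_X ^ j * (fps_X :: complex fps)"
        "fps_X ^ Suc j = fps_X ^ j * (fps_X :: complex fps)"
        "fps_X ^ (j + 2) = fps_X ^ j * fps_X * (fps_X :: complex fps)"
        "fps_X ^ (j + 3) = fps_X ^ j * fps_X * fps_X * (fps_X :: complex fps)"
        by (simp_all add: j(2) power_add power2_eq_square power3_eq_cube)
      show ?thesis
        unfolding r_def E'_def v_def w_def[symmetric] by (rule branch_identity[OF e1 V_def e2])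
    qed
    finally have "?A (Suc i + 3) = fps_to_fls (1 + fps_X ^ (N - Suc i) * (x + fps_X * E' x))"
      by (simp add: j_def)
    then show ?thesis unfolding Let_def using V_eq by blast
  qed
  then show ?case using V E' by blast
qed

definition rat_fls :: "complex fls \<Rightarrow> bool" where
  "rat_fls f \<longleftrightarrow> (\<forall>i. fls_nth f i \<in> \<rat>)"

text \<open>At index n the power of t in front of x has exponent 0, so the numerator vanishes once x
  solves \<open>x = - 1 - fps_X * E x\<close>. The earlier numerators have constant term 1.\<close>

lemma branch_at_infinity:
  assumes n: "n \<ge> 3"
  obtains c where "rat_fls c" "c \<noteq> 0" "orb_num fls_X_inv c n = 0"
    "\<And>k. 0 < k \<Longrightarrow> k < n \<Longrightarrow> orb_num fls_X_inv c k \<noteq> 0"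
proof -
  define N where "N = n - 3"
  have nN: "n = N + 3" using n by (simp add: N_def)
  obtain E where E: "admissible E" and
    En: "\<And>x. orb_num fls_X_inv (- fls_X_inv + fps_to_fls (fps_X ^ N * x)) n = fps_to_fls (1 + (x + fps_X * E x))"
    using orb_num_at_infinity[of N N] by (auto simp: Let_def nN)
  obtain x where x: "rat_fps x" "x = - 1 - fps_X * E x" using admissible_fixpoint[OF E] by blast
  define c where "c = - fls_X_inv + fps_to_fls (fps_X ^ N * x)"
  have "rat_fps (fps_X ^ N * x)" by (intro rat_fps_intros rat_fps_power x)
  then have "rat_fls c" by (auto simp: c_def rat_fls_def rat_fps_def intro!: Rats_add)
  moreover have "fls_nth c (-1) = -1" by (simp add: c_def)
  then have "c \<noteq> 0" by auto
  moreover have "1 + (x + fps_X * E x) = 0" using x(2) by (simp add: algebra_simps)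
  then have "orb_num fls_X_inv c n = 0" unfolding c_def En by simp
  moreover have "orb_num fls_X_inv c k \<noteq> 0" if k: "0 < k" "k < n" for k
  proof (cases "k < 3")
    case True
    then have "k = 1 \<or> k = 2" using k by auto
    then show ?thesis by (auto simp: numeral_2_eq_2)
  next
    case False
    define i where "i = k - 3"
    have i: "k = i + 3" "i < N" using False k nN by (auto simp: i_def)
    obtain E' where "orb_num fls_X_inv c k = fps_to_fls (1 + fps_X ^ (N - i) * (x + fps_X * E' x))"
      using orb_num_at_infinity[of i N] i by (auto simp: Let_def c_def)
    moreover have "fps_nth (1 + fps_X ^ (N - i) * (x + fps_X * E' x)) 0 = 1" using i(2) by simp
    then have "1 + fps_X ^ (N - i) * (x + fps_X * E' x) \<noteq> 0" by (metis fps_zero_nth zero_neq_one)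
    ultimately show ?thesis by (metis fps_to_fls_eq_0_iff)
  qed
  ultimately show ?thesis using that by blast
qed

subsection \<open>Irreducibility of the parameter curve\<close>

lemma ring_hom_fun_fls_const: "ring_hom_fun (fls_const :: complex \<Rightarrow> complex fls)"
  by (simp add: ring_hom_fun_def fls_plus_const)

lemma ring_hom_fun_of_rat: "ring_hom_fun (of_rat :: rat \<Rightarrow> complex)"
  by (simp add: ring_hom_fun_def of_rat_add of_rat_mult)

definition rat_linear :: "(complex \<Rightarrow> rat) \<Rightarrow> bool" where
  "rat_linear L \<longleftrightarrow> (\<forall>x y. L (x + y) = L x + L y) \<and> (\<forall>q x. L (of_rat q * x) = q * L x)"

text \<open>The complex numbers form a rational vector space, in which \<open>{a}\<close> is
  independent.\<close>

lemma rat_linear_functional: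
  assumes "a \<noteq> 0"
  obtains L where "rat_linear L" "L a = 1"
proof -
  interpret vector_space_pair "\<lambda>(q::rat) (z::complex). of_rat q * z" "\<lambda>(q::rat) (r::rat). q * r"
    by unfold_locales (simp_all add: algebra_simps of_rat_add of_rat_mult)
  have "vs1.independent {a}" using assms by simp
  then obtain L where L: "Vector_Spaces.linear (\<lambda>(q::rat) (z::complex). of_rat q * z) (*) L" "\<forall>x\<in>{a}. L x = 1"
    using linear_independent_extend[of "{a}" "\<lambda>_. 1"] by blast
  interpret L: Vector_Spaces.linear "\<lambda>(q::rat) (z::complex). of_rat q * z" "(*)" L by (rule L(1))
  have "rat_linear L" unfolding rat_linear_def using L.add L.scale by blast
  then show ?thesis using that L(2) by blast
qed

lemma rat_linear_0: "rat_linear L \<Longrightarrow> L 0 = 0"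
  unfolding rat_linear_def by (metis mult_zero_left of_rat_0)

lemma rat_fls_mult:
  assumes "rat_fls f" "rat_fls g"
  shows "rat_fls (f * g)"
  unfolding rat_fls_def fls_times_nth(1) using assms
  by (auto simp: rat_fls_def intro!: Rats_sum Rats_mult)

lemma rat_fls_X_inv: "rat_fls fls_X_inv"
  by (simp add: rat_fls_def)

text \<open>Substituting rational series makes each coefficient of the result a rational linear
  combination of coefficients of \<open>P\<close>, so the functional may be applied before or after.
  The factor \<open>r\<close> carries the powers of \<open>b\<close> and \<open>c\<close> split off
  in the induction.\<close>

lemma eval2_rat_linear:
  fixes P :: "complex poly poly"
  assumes L: "rat_linear L" and b: "rat_fls b" and c: "rat_fls c" and r: "rat_fls r"
  defines "L' \<equiv> \<lambda>x. of_rat (L x) :: complex"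
  shows "fls_nth (eval2 fls_const b c (map_poly (map_poly L') P) * r) m = L' (fls_nth (eval2 fls_const b c P * r) m)"
proof -
  have L'0: "L' 0 = 0" by (simp add: L'_def rat_linear_0[OF L])
  have L'add: "L' (x + y) = L' x + L' y" for x y
    using L by (simp add: L'_def rat_linear_def of_rat_add)
  have L'mult: "L' (x * q) = L' x * q" if "q \<in> \<rat>" for x q
  proof -
    from that obtain q' where "q = of_rat q'" by (elim Rats_cases)
    then show ?thesis using L by (simp add: L'_def rat_linear_def of_rat_mult mult.commute)
  qed
  have inner: "fls_nth (poly (map_poly fls_const (map_poly L' p)) b * r) m = L' (fls_nth (poly (map_poly fls_const p) b * r) m)"
    if "rat_fls r" for p :: "complex poly" and r
    using that
  proof (induction p arbitrary: r)
    case (pCons a p)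
    have e: "(fls_const x + b * y) * r = fls_const x * r + y * (b * r)" for x y by (simp add: algebra_simps)
    have "rat_fls (b * r)" by (rule rat_fls_mult[OF b pCons.prems])
    from pCons.IH[OF this] show ?case using pCons.prems
      by (simp add: map_poly_pCons L'0 e L'add L'mult rat_fls_def)
  qed (simp add: L'0)
  show ?thesis using r
  proof (induction P arbitrary: r)
    case (pCons p P)
    have e: "(x + c * y) * r = x * r + y * (c * r)" for x y by (simp add: algebra_simps)
    have "rat_fls (c * r)" by (rule rat_fls_mult[OF c pCons.prems])
    from pCons.IH[OF this] show ?case
      by (simp add: map_poly_pCons L'0 eval2_pCons[OF ring_hom_fun_fls_const] e L'add inner[OF pCons.prems])
  qed (simp add: L'0)
qed

text \<open>\<open>fls_X_inv\<close> is transcendental over the constants: the most negative power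
  in the value carries the leading coefficient of \<open>d\<close>.\<close>

lemma eval2_X_inv_const_neq_0:
  assumes "d \<noteq> 0"
  shows "poly (map_poly fls_const d) fls_X_inv \<noteq> (0 :: complex fls)"
proof
  have deg: "degree (map_poly fls_const d) = degree d"
    using assms by (intro map_poly_degree_eq) auto
  have "fls_nth (poly (map_poly fls_const d) fls_X_inv) (- int (degree d)) = 
    (\<Sum>i\<le>degree d. if i = degree d then coeff d i else 0)"
    unfolding poly_altdef deg fls_nth_sum by (intro sum.cong) (auto simp: coeff_map_poly)
  also have "\<dots> = lead_coeff d" by simp
  finally show "poly (map_poly fls_const d) fls_X_inv = (0 :: complex fls) \<Longrightarrow> False" using assms by simp
qed

lemma gen_orb_neq_0: "n > 0 \<Longrightarrow> gen_orb n \<noteq> 0"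
  using orb_num_0_0[of "n - 1", where 'a = complex] ev_gen_orb[of 0 0 n] by fastforce

text \<open>
  Applying a \<open>\<rat>\<close>-linear functional to the coefficients of \<open>H\<close> yields a polynomial of
  no larger degrees that still vanishes on the rational branch.
\<close>

lemma rational_component:
  assumes n: "n \<ge> 3"
  obtains H Q \<kappa> where "prime_elem H" "degree H > 0" "H dvd gen_orb n"
    "\<not> H dvd [:0, 1:]" "\<forall>k. 0 < k \<and> k < n \<longrightarrow> \<not> H dvd gen_orb k"
    "\<kappa> \<noteq> 0" "map_poly (map_poly of_rat) Q = [:[:\<kappa>:]:] * H"
proof -
  obtain c where c: "rat_fls c" "c \<noteq> 0" "orb_num fls_X_inv c n = 0"
    "\<And>k. 0 < k \<Longrightarrow> k < n \<Longrightarrow> orb_num fls_X_inv c k \<noteq> 0" using branch_at_infinity[OF n] by blast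
  define \<phi> where "\<phi> = eval2 fls_const fls_X_inv c"
  have \<phi>: "ring_hom_fun \<phi>" unfolding \<phi>_def by (rule ring_hom_fun_eval2[OF ring_hom_fun_fls_const])
  have \<phi>_orb: "\<phi> (gen_orb k) = orb_num fls_X_inv c k" for k
    unfolding \<phi>_def by (rule eval2_gen_orb[OF ring_hom_fun_fls_const])
  have \<phi>_const: "\<phi> [:d:] \<noteq> 0" if "d \<noteq> 0" for d
    unfolding \<phi>_def eval2_const[OF ring_hom_fun_fls_const] by (rule eval2_X_inv_const_neq_0[OF that])
  have \<phi>_dvd: "\<phi> P = 0" if "H dvd P" "\<phi> H = 0" for H P
    using that by (auto simp: dvd_def ring_hom_funD[OF \<phi>])
  obtain H where H: "prime_elem H" "H dvd gen_orb n" "\<phi> H = 0"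
    using prime_elem_factor_in_kernel[OF \<phi>, of "gen_orb n"] gen_orb_neq_0[of n] n c(3) by (auto simp: \<phi>_orb)
  have H0: "H \<noteq> 0" using H(1) by auto
  have deg: "degree H > 0"
  proof (rule ccontr)
    assume "\<not> degree H > 0"
    then obtain d where "H = [:d:]" by (meson degree_eq_zeroE gr0I)
    then show False using H0 \<phi>_const[of d] H(3) by auto
  qed
  \<comment> \<open>The functional is normalised at a nonzero coefficient so that the image
    \<open>K\<close> of \<open>H\<close> is nonzero.\<close>
  obtain i j where ij: "coeff (coeff H i) j \<noteq> 0" using H0 by (metis leading_coeff_0_iff)
  obtain L where L: "rat_linear L" "L (coeff (coeff H i) j) = 1" using rat_linear_functional[OF ij] by blast
  define L' where "L' x = (of_rat (L x) :: complex)" for x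
  have L'0: "L' 0 = 0" by (simp add: L'_def rat_linear_0[OF L(1)])
  define Q where "Q = map_poly (map_poly L) H"
  define K where "K = map_poly (map_poly L') H"
  have QK: "map_poly (map_poly of_rat) Q = K"
    unfolding Q_def K_def by (intro poly_eqI) (simp add: coeff_map_poly L'_def rat_linear_0[OF L(1)])
  have "coeff (coeff K i) j = 1" by (simp add: K_def coeff_map_poly L'0, simp add: L'_def L(2))
  then have K0: "K \<noteq> 0" by auto
  have "rat_fls 1" by (simp add: rat_fls_def)
  have "\<phi> K = 0"
  proof (rule fls_eqI)
    fix m
    have "fls_nth (\<phi> K * 1) m = L' (fls_nth (\<phi> H * 1) m)"
      unfolding \<phi>_def K_def L'_def[abs_def] by (rule eval2_rat_linear[OF L(1) rat_fls_X_inv c(1) \<open>rat_fls 1\<close>])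
    then show "fls_nth (\<phi> K) m = fls_nth 0 m" by (simp add: H(3) L'0)
  qed
  \<comment> \<open>Otherwise elimination gives a nonzero polynomial in b alone that vanishes on the
    branch.\<close>
  have "H dvd K"
  proof (rule ccontr)
    assume "\<not> H dvd K"
    then obtain U V d where d: "d \<noteq> 0" "U * H + V * K = [:d:]" using prime_elem_bezout[OF H(1) deg] by blast
    have "\<phi> (U * H + V * K) = 0" by (simp add: ring_hom_funD[OF \<phi>] H(3) \<open>\<phi> K = 0\<close>)
    then show False using \<phi>_const[OF d(1)] d(2) by simp
  qed
  then obtain R where R: "K = H * R" by (auto simp: dvd_def)
  \<comment> \<open>The functional raises the degree in neither variable, which forces the cofactor
    of \<open>H\<close> to be a scalar.\<close>
  have "degree K \<le> degree H" unfolding K_def by (rule map_poly_degree_leq)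
  then have "degree R = 0" using R K0 H0 by (auto simp: degree_mult_eq)
  then obtain k where k: "R = [:k:]" by (meson degree_eq_zeroE)
  have coeffK: "coeff K i = coeff H i * k" for i by (simp add: R k)
  obtain i where i: "coeff K i \<noteq> 0" using K0 by (metis leading_coeff_0_iff)
  have "degree (coeff K i) \<le> degree (coeff H i)"
    unfolding K_def by (simp add: coeff_map_poly map_poly_degree_leq L'0)
  then have "degree k = 0" using i unfolding coeffK by (auto simp: degree_mult_eq)
  then obtain \<kappa> where \<kappa>: "k = [:\<kappa>:]" by (meson degree_eq_zeroE)
  have "\<kappa> \<noteq> 0" using i by (auto simp: coeffK \<kappa>)
  moreover have "map_poly (map_poly of_rat) Q = [:[:\<kappa>:]:] * H" unfolding QK R k \<kappa> by (rule mult.commute)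
  moreover have "\<phi> [:0, 1:] = c" unfolding \<phi>_def by (rule eval2_vars(2)[OF ring_hom_fun_fls_const])
  then have "\<not> H dvd [:0, 1:]" using \<phi>_dvd[OF _ H(3)] c(2) by blast
  moreover have "\<not> H dvd gen_orb k" if "0 < k" "k < n" for k
    using \<phi>_dvd[OF _ H(3), of "gen_orb k"] c(4)[OF that] by (auto simp: \<phi>_orb)
  ultimately show ?thesis using that[OF H(1) deg H(2)] by blast
qed

section \<open>Rational functions on the curve of polynomial maps\<close>

text \<open>Off C = -1, these are the elements of Q[C, 1 / (1 + C)], and their zeros there are those
  of a rational polynomial.\<close>

definition rat_fun :: "(complex \<Rightarrow> complex) \<Rightarrow> bool" where
  "rat_fun F \<longleftrightarrow> (\<exists>N q. \<forall>C. 1 + C \<noteq> 0 \<longrightarrow> (1 + C) ^ N * F C = poly (map_poly of_rat q) C)"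

lemmas hom_rat_poly = ring_hom_fun_poly_map[OF ring_hom_fun_of_rat]

lemma rat_fun_const: "rat_fun (\<lambda>C. of_rat q)"
  unfolding rat_fun_def by (rule exI[of _ 0], rule exI[of _ "[:q:]"]) (simp add: map_poly_pCons)

lemma rat_fun_poly_b: "rat_fun poly_b"
  unfolding rat_fun_def poly_b_def by (rule exI[of _ 2], rule exI[of _ "[:0, -2:]"]) (simp add: map_poly_pCons of_rat_minus)

lemma rat_fun_poly_c: "rat_fun poly_c"
  unfolding rat_fun_def poly_c_def by (rule exI[of _ 3], rule exI[of _ "[:0, 0, 1:]"]) (simp add: map_poly_pCons power2_eq_square)

lemma rat_fun_mult:
  assumes "rat_fun F" "rat_fun F'"
  shows "rat_fun (\<lambda>C. F C * F' C)"
proof -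
  obtain N q N' q' where q: "\<And>C. 1 + C \<noteq> 0 \<Longrightarrow> (1 + C) ^ N * F C = poly (map_poly of_rat q) C"
    "\<And>C. 1 + C \<noteq> 0 \<Longrightarrow> (1 + C) ^ N' * F' C = poly (map_poly of_rat q') C"
    using assms unfolding rat_fun_def by metis
  have "(1 + C) ^ (N + N') * (F C * F' C) = poly (map_poly of_rat (q * q')) C" if "1 + C \<noteq> 0" for C
    unfolding ring_hom_funD(4)[OF hom_rat_poly] q[OF that, symmetric] by (simp add: power_add)
  then show ?thesis unfolding rat_fun_def by blast
qed

lemma rat_fun_add:
  assumes "rat_fun F" "rat_fun F'"
  shows "rat_fun (\<lambda>C. F C + F' C)"
proof -
  obtain N q N' q' where q: "\<And>C. 1 + C \<noteq> 0 \<Longrightarrow> (1 + C) ^ N * F C = poly (map_poly of_rat q) C"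
    "\<And>C. 1 + C \<noteq> 0 \<Longrightarrow> (1 + C) ^ N' * F' C = poly (map_poly of_rat q') C"
    using assms unfolding rat_fun_def by metis
  have p: "poly (map_poly of_rat ([:1, 1:] ^ M)) C = (1 + C) ^ M" for C :: complex and M
    unfolding ring_hom_fun_power[OF hom_rat_poly] by (simp add: map_poly_pCons)
  have "(1 + C) ^ (N + N') * (F C + F' C) = poly (map_poly of_rat ([:1, 1:] ^ N' * q + [:1, 1:] ^ N * q')) C"
    if "1 + C \<noteq> 0" for C
    unfolding ring_hom_funD(3,4)[OF hom_rat_poly] q[OF that, symmetric] p by (simp add: power_add algebra_simps)
  then show ?thesis unfolding rat_fun_def by blast
qed

lemma rat_fun_ev: "rat_fun (\<lambda>C. ev (map_poly (map_poly of_rat) Q) (poly_b C) (poly_c C))"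
proof (induction Q)
  case 0
  show ?case using rat_fun_const[of 0] by simp
next
  case (pCons q Q)
  have "rat_fun (\<lambda>C. poly (map_poly of_rat q) (poly_b C))"
  proof (induction q)
    case 0
    show ?case using rat_fun_const[of 0] by simp
  qed (auto simp: map_poly_pCons intro!: rat_fun_add rat_fun_mult rat_fun_const rat_fun_poly_b)
  then show ?case using pCons
    by (auto simp: map_poly_pCons eval2_pCons[OF ring_hom_fun_id] intro!: rat_fun_add rat_fun_mult rat_fun_poly_c)
qed

text \<open>\<open>G\<close> divides every rational polynomial sharing a root with it, since
  otherwise the two would combine to a nonzero constant.\<close>

lemma irreducible_rat_conjugate_roots:
  fixes G q :: "rat poly" and x y :: complex
  assumes G: "irreducible G" and x: "poly (map_poly of_rat G) x = 0" "poly (map_poly of_rat q) x = 0"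
    and y: "poly (map_poly of_rat G) y = 0"
  shows "poly (map_poly of_rat q) y = 0"
proof -
  have prime: "prime_elem G" by (rule irreducible_imp_prime_elem[OF G])
  have "degree G > 0"
    using irreducible_def[of G] G by (metis gr0I is_unit_iff_degree)
  have "G dvd q"
  proof (rule ccontr)
    assume "\<not> G dvd q"
    then obtain U V d where d: "d \<noteq> 0" "U * G + V * q = [:d:]"
      using prime_elem_bezout[OF prime \<open>degree G > 0\<close>] by blast
    have "poly (map_poly of_rat (U * G + V * q)) x = 0"
      unfolding ring_hom_funD(3,4)[OF hom_rat_poly] x by simp
    then show False unfolding d(2) using d(1) by (simp add: map_poly_pCons)
  qed
  then show ?thesis using y ring_hom_funD(4)[OF hom_rat_poly] by (auto simp: dvd_def)
qed

section \<open>The parameter set and its irreducibility\<close>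

text \<open>The parameters for which 0 has exact period n under
  \<open>1 + b / z + c / z\<^sup>2\<close>, see \<open>norm_pair_exact_period\<close>; at
  \<open>c = 0\<close> the degree drops below 2.\<close>

definition per_params :: "nat \<Rightarrow> (complex \<times> complex) set" where
  "per_params n = {(b, c). c \<noteq> 0 \<and> orb_num b c n = 0 \<and> (\<forall>k. 0 < k \<and> k < n \<longrightarrow> orb_num b c k \<noteq> 0)}"

text \<open>The component \<open>H\<close> from \<open>rational_component\<close> contains all of
  \<open>per_params n\<close>, and it divides \<open>P * R * D\<close> but not
  \<open>D\<close>.\<close>

lemma per_params_irreducible:
  assumes n: "n \<ge> 3" and G: "is_gleason_poly n G" "irreducible G"
    and van: "\<And>b c. (b, c) \<in> per_params n \<Longrightarrow> ev P b c = 0 \<or> ev R b c = 0"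
  shows "(\<forall>(b, c)\<in>per_params n. ev P b c = 0) \<or> (\<forall>(b, c)\<in>per_params n. ev R b c = 0)"
proof -
  have n0: "n > 0" using n by simp
  have G_root: "poly (map_poly of_rat G) C = 0 \<longleftrightarrow> gleason_point n C" for C
    using G(1) by (simp add: is_gleason_poly_def gleason_point_def)
  obtain H Q \<kappa> where H: "prime_elem H" "degree H > 0" "H dvd gen_orb n"
    "\<not> H dvd [:0, 1:]" "\<forall>k. 0 < k \<and> k < n \<longrightarrow> \<not> H dvd gen_orb k"
    and \<kappa>: "\<kappa> \<noteq> 0" "map_poly (map_poly of_rat) Q = [:[:\<kappa>:]:] * H"
    by (rule rational_component[OF n])
  have evQ: "ev (map_poly (map_poly of_rat) Q) b c = \<kappa> * ev H b c" for b c
    unfolding \<kappa>(2) ev_simps(4) by (simp add: eval2_const[OF ring_hom_fun_id])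
  obtain N q where q: "\<And>C. 1 + C \<noteq> 0 \<Longrightarrow> (1 + C) ^ N * (\<kappa> * ev H (poly_b C) (poly_c C)) = poly (map_poly of_rat q) C"
    using rat_fun_ev[of Q] unfolding rat_fun_def evQ by blast
  obtain C0 where C0: "C0 \<noteq> 0" "1 + C0 \<noteq> 0" "gleason_point n C0" "ev H (poly_b C0) (poly_c C0) = 0"
    using meets_gleason_point[OF H(1,3) n0] H(5) by blast
  \<comment> \<open>\<open>q\<close> is a rational numerator of \<open>H\<close> on the curve of
    polynomial maps; it vanishes at the root \<open>C0\<close> of \<open>G\<close>, hence at all
    roots of \<open>G\<close>.\<close>
  have H_gleason: "ev H (poly_b C) (poly_c C) = 0" if "1 + C \<noteq> 0" "gleason_point n C" for C
  proof -
    have "poly (map_poly of_rat q) C0 = 0" using q[OF C0(2)] C0(4) by simp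
    then have "poly (map_poly of_rat q) C = 0"
      by (rule irreducible_rat_conjugate_roots[OF G(2), of C0, rotated]) (simp_all add: G_root C0(3) that(2))
    then show ?thesis using q[OF that(1)] that(1) \<kappa>(1) by simp
  qed
  \<comment> \<open>The point lies on a prime factor \<open>H1\<close> that meets the curve of
    polynomial maps at a root of \<open>G\<close>, where \<open>H\<close> vanishes too. If
    \<open>H1\<close> did not divide \<open>H\<close>, both would be factors of
    \<open>gen_orb n\<close> vanishing there.\<close>
  have H_all: "ev H b c = 0" if bc: "(b, c) \<in> per_params n" for b c
  proof -
    have "ev (gen_orb n) b c = 0" using bc by (simp add: per_params_def ev_gen_orb)
    then obtain H1 where H1: "prime_elem H1" "H1 dvd gen_orb n" "ev H1 b c = 0"
      using prime_elem_factor_in_kernel[OF hom_ev] gen_orb_neq_0[OF n0] by blast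
    have H1k: "\<not> H1 dvd gen_orb k" if "0 < k" "k < n" for k
    proof
      assume "H1 dvd gen_orb k"
      then have "ev (gen_orb k) b c = 0" using H1(3) by (auto simp: dvd_def ev_simps)
      then show False using bc that by (simp add: per_params_def ev_gen_orb)
    qed
    obtain C1 where C1: "C1 \<noteq> 0" "1 + C1 \<noteq> 0" "gleason_point n C1" "ev H1 (poly_b C1) (poly_c C1) = 0"
      using meets_gleason_point[OF H1(1,2) n0 H1k] by blast
    have "H1 dvd H"
    proof (rule ccontr)
      assume ndvd: "\<not> H1 dvd H"
      obtain Q' where Q': "gen_orb n = H * Q'" using H(3) by (auto simp: dvd_def)
      then have "H1 dvd Q'" using H1 ndvd by (simp add: prime_elem_dvd_mult_iff)
      then have "H * H1 dvd gen_orb n" unfolding Q' by (rule mult_dvd_mono[OF dvd_refl])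
      then show False
        using gen_orb_simple_on_polys[OF C1(1,2) n0] H_gleason[OF C1(2,3)] C1(4) by blast
    qed
    then show ?thesis using H1(3) by (auto simp: dvd_def ev_simps)
  qed
  \<comment> \<open>Zeros of \<open>H\<close> with \<open>D\<close> nonzero lie in
    \<open>per_params n\<close>; the factor \<open>D\<close> takes care of the others when the
    Nullstellensatz is applied to all of \<open>H = 0\<close>.\<close>
  define D where "D = [:0, 1:] * (\<Prod>k\<in>{0<..<n}. gen_orb k)"
  have D: "(b, c) \<in> per_params n" if "ev (gen_orb n) b c = 0" "ev D b c \<noteq> 0" for b c
  proof -
    have "ev D b c = c * (\<Prod>k\<in>{0<..<n}. orb_num b c k)"
      unfolding D_def ev_simps(4) ring_hom_fun_prod[OF hom_ev] ev_gen_orb eval2_vars[OF ring_hom_fun_id] ..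
    then show ?thesis using that by (auto simp: per_params_def ev_gen_orb)
  qed
  have "\<not> H dvd (\<Prod>k\<in>A. gen_orb k)" if "finite A" "A \<subseteq> {0<..<n}" for A
    using that
  proof (induction A rule: finite_induct)
    case empty
    then show ?case using H(1) by (simp add: prime_elem_not_unit)
  next
    case (insert k A)
    then show ?case using H(1) H(5) by (auto simp: prime_elem_dvd_mult_iff)
  qed
  then have HD: "\<not> H dvd D" unfolding D_def using H(1,4) by (simp add: prime_elem_dvd_mult_iff del: mult_pCons_left)
  have "H dvd P * R * D"
  proof (rule nullstellensatz_curve[OF H(1,2)])
    fix b c assume "ev H b c = 0"
    then have "ev (gen_orb n) b c = 0" using H(3) by (auto simp: dvd_def ev_simps)
    then have "ev D b c = 0 \<or> ev P b c = 0 \<or> ev R b c = 0" using D van by blast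
    then show "ev (P * R * D) b c = 0" by (auto simp: ev_simps)
  qed
  then have "H dvd P \<or> H dvd R" using H(1) HD by (simp add: prime_elem_dvd_mult_iff)
  then show ?thesis using H_all by (auto simp: dvd_def ev_simps)
qed

text \<open>A root of \<open>G\<close> supplies a polynomial map. It is neither 0 nor -1, where the
  critical orbit has period 1 and 2.\<close>

lemma per_params_nonempty:
  assumes n: "n \<ge> 3" and G: "is_gleason_poly n G" "irreducible G"
  shows "per_params n \<noteq> {}"
proof -
  have "degree G > 0" using G(2) irreducible_def[of G] by (metis gr0I is_unit_iff_degree)
  then have "degree (map_poly of_rat G :: complex poly) > 0" by (subst map_poly_degree_eq) auto
  then obtain C :: complex where "poly (map_poly of_rat G) C = 0"
    using fundamental_theorem_of_algebra[of "map_poly of_rat G"] by (auto simp: constant_degree)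
  then have C: "gleason_point n C" using G(1) by (simp add: is_gleason_poly_def gleason_point_def)
  then have "crit_orbit C 1 \<noteq> 0" "crit_orbit C 2 \<noteq> 0" using n unfolding gleason_point_iff by auto
  then have C0: "C \<noteq> 0" "1 + C \<noteq> 0"
    by (auto simp: numeral_2_eq_2 power2_eq_square add_eq_0_iff)
  then have "(poly_b C, poly_c C) \<in> per_params n"
    using C orb_num_poly_eq_0_iff[OF C0] by (auto simp: per_params_def gleason_point_iff poly_c_def)
  then show ?thesis by blast
qed

subsection \<open>The projective line and its automorphisms\<close>

text \<open>The point [X : Y]; the zero vector gets the default value \<open>Infty\<close>.\<close>

definition hpt :: "complex \<Rightarrow> complex \<Rightarrow> proj_line" where
  "hpt X Y = (if Y = 0 then Infty else Aff (X / Y))"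

lemma hpt_cases:
  obtains X Y where "x = hpt X Y" "X \<noteq> 0 \<or> Y \<noteq> 0"
proof (cases x)
  case (Aff z)
  then show ?thesis using that[of z 1] by (simp add: hpt_def)
next
  case Infty
  then show ?thesis using that[of 1 0] by (simp add: hpt_def)
qed

lemma hpt_eq_iff:
  assumes "X \<noteq> 0 \<or> Y \<noteq> 0" "X' \<noteq> 0 \<or> Y' \<noteq> 0"
  shows "hpt X Y = hpt X' Y' \<longleftrightarrow> X * Y' = X' * Y"
  using assms by (auto simp: hpt_def field_simps)

lemma hpt_scale: "k \<noteq> 0 \<Longrightarrow> hpt (k * X) (k * Y) = hpt X Y"
  by (simp add: hpt_def)

text \<open>The binary form of degree d attached to \<open>p\<close>, where d comes from the pair
  and may exceed the degree of \<open>p\<close>.\<close>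

definition hom_eval :: "nat \<Rightarrow> complex poly \<Rightarrow> complex \<Rightarrow> complex \<Rightarrow> complex" where
  "hom_eval d p X Y = (\<Sum>i\<le>d. coeff p i * X ^ i * Y ^ (d - i))"

lemma hom_eval_0: "hom_eval d p X 0 = coeff p d * X ^ d"
proof -
  have "hom_eval d p X 0 = (\<Sum>i\<le>d. if i = d then coeff p i * X ^ i else 0)"
    unfolding hom_eval_def by (intro sum.cong) auto
  then show ?thesis by simp
qed

lemma hom_eval_nz:
  assumes "degree p \<le> d" "Y \<noteq> 0"
  shows "hom_eval d p X Y = Y ^ d * poly p (X / Y)"
proof -
  have "poly p (X / Y) = (\<Sum>i\<le>d. coeff p i * (X / Y) ^ i)"
    unfolding poly_altdef using assms(1) by (intro sum.mono_neutral_left) (auto simp: coeff_eq_0)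
  also have "Y ^ d * \<dots> = hom_eval d p X Y"
    unfolding hom_eval_def sum_distrib_left
  proof (intro sum.cong refl)
    fix i assume "i \<in> {..d}"
    then have "Y ^ d = Y ^ (d - i) * Y ^ i" by (simp flip: power_add)
    then show "Y ^ d * (coeff p i * (X / Y) ^ i) = coeff p i * X ^ i * Y ^ (d - i)"
      using assms(2) by (simp add: power_divide)
  qed
  finally show ?thesis by simp
qed

lemma hom_eval_1: "hom_eval (Suc 0) p X Y = coeff p (Suc 0) * X + coeff p 0 * Y"
  by (simp add: hom_eval_def)

lemma hom_eval_2: "hom_eval 2 p X Y = coeff p 0 * Y\<^sup>2 + coeff p 1 * X * Y + coeff p 2 * X\<^sup>2"
  by (simp add: hom_eval_def numeral_2_eq_2)

text \<open>A common zero of the forms is a common root of \<open>p\<close> and \<open>q\<close> or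
  the point [1 : 0], where vanishing means that both degrees are below d. In this shape the
  condition is visibly stable under linear substitutions.\<close>

lemma coprime_pairs_iff:
  assumes d: "d > 0"
  shows "(p, q) \<in> coprime_pairs d \<longleftrightarrow> degree p \<le> d \<and> degree q \<le> d \<and>
    (\<forall>X Y. X \<noteq> 0 \<or> Y \<noteq> 0 \<longrightarrow> hom_eval d p X Y \<noteq> 0 \<or> hom_eval d q X Y \<noteq> 0)"
    (is "_ \<longleftrightarrow> ?R")
proof
  assume "(p, q) \<in> coprime_pairs d"
  then have cop: "coprime p q" and max: "max (degree p) (degree q) = d" by (auto simp: coprime_pairs_def)
  have deg: "degree p \<le> d" "degree q \<le> d" using max by auto
  have "hom_eval d p X Y \<noteq> 0 \<or> hom_eval d q X Y \<noteq> 0" if XY: "X \<noteq> 0 \<or> Y \<noteq> 0" for X Y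
  proof (cases "Y = 0")
    case True
    have "degree p = d \<or> degree q = d" using max by (auto simp: max_def split: if_splits)
    then have "coeff p d \<noteq> 0 \<or> coeff q d \<noteq> 0" using d by (metis degree_0 leading_coeff_0_iff less_irrefl)
    then show ?thesis using True XY by (simp add: hom_eval_0)
  next
    case False
    have "\<not> (poly p (X / Y) = 0 \<and> poly q (X / Y) = 0)"
    proof
      assume "poly p (X / Y) = 0 \<and> poly q (X / Y) = 0"
      then have "is_unit [:- (X / Y), 1:]" using cop by (metis coprime_common_divisor poly_eq_0_iff_dvd)
      then show False by (simp add: is_unit_pCons_iff)
    qed
    then show ?thesis using False deg by (simp add: hom_eval_nz)
  qed
  then show ?R using deg by blast
next
  assume R: ?R
  then have deg: "degree p \<le> d" "degree q \<le> d" by auto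
  have "coeff p d \<noteq> 0 \<or> coeff q d \<noteq> 0" using R[THEN conjunct2, THEN conjunct2, rule_format, of 1 0] by (simp add: hom_eval_0)
  then have "max (degree p) (degree q) = d" using deg by (metis le_antisym le_degree max.absorb1 max.absorb2 max.cobounded1 max.cobounded2)
  moreover have "coprime p q"
  proof (rule coprimeI)
    fix g assume g: "g dvd p" "g dvd q"
    show "is_unit g"
    proof (rule ccontr)
      assume "\<not> is_unit g"
      then have "g = 0 \<or> degree g > 0" by (metis gr0I is_unit_iff_degree)
      then obtain z where "poly g z = 0"
        using fundamental_theorem_of_algebra[of g] by (auto simp: constant_degree)
      then have "poly p z = 0" "poly q z = 0" using g by (auto simp: dvd_def)
      then show False using R[THEN conjunct2, THEN conjunct2, rule_format, of z 1] deg by (simp add: hom_eval_nz)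
    qed
  qed
  ultimately show "(p, q) \<in> coprime_pairs d" by (simp add: coprime_pairs_def)
qed

lemma ratmap_hpt:
  assumes "(p, q) \<in> coprime_pairs d" "X \<noteq> 0 \<or> Y \<noteq> 0"
  shows "ratmap (p, q) (hpt X Y) = hpt (hom_eval d p X Y) (hom_eval d q X Y)"
proof (cases "Y = 0")
  case True
  have "max (degree p) (degree q) = d" using assms(1) by (simp add: coprime_pairs_def)
  then show ?thesis using True assms(2) by (simp add: hpt_def hom_eval_0 Let_def)
next
  case False
  have "degree p \<le> d" "degree q \<le> d" using assms(1) by (auto simp: coprime_pairs_def)
  then show ?thesis using False by (simp add: hpt_def hom_eval_nz)
qed

definition mob :: "complex \<Rightarrow> complex \<Rightarrow> complex \<Rightarrow> complex \<Rightarrow> proj_line \<Rightarrow> proj_line" where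
  "mob \<alpha> \<beta> \<gamma> \<delta> = ratmap ([:\<beta>, \<alpha>:], [:\<delta>, \<gamma>:])"

lemma det_neq_0_ker:
  fixes \<alpha> \<beta> \<gamma> \<delta> X Y :: complex
  assumes "\<alpha> * \<delta> - \<beta> * \<gamma> \<noteq> 0" "X \<noteq> 0 \<or> Y \<noteq> 0"
  shows "\<alpha> * X + \<beta> * Y \<noteq> 0 \<or> \<gamma> * X + \<delta> * Y \<noteq> 0"
proof (rule ccontr)
  assume "\<not> ?thesis"
  then have z: "\<alpha> * X + \<beta> * Y = 0" "\<gamma> * X + \<delta> * Y = 0" by auto
  have "(\<alpha> * \<delta> - \<beta> * \<gamma>) * X = \<delta> * (\<alpha> * X + \<beta> * Y) - \<beta> * (\<gamma> * X + \<delta> * Y)"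
    "(\<alpha> * \<delta> - \<beta> * \<gamma>) * Y = \<alpha> * (\<gamma> * X + \<delta> * Y) - \<gamma> * (\<alpha> * X + \<beta> * Y)"
    by (simp_all add: algebra_simps)
  then show False using z assms by simp
qed

lemma mob_pair:
  assumes "\<alpha> * \<delta> - \<beta> * \<gamma> \<noteq> 0"
  shows "([:\<beta>, \<alpha>:], [:\<delta>, \<gamma>:]) \<in> coprime_pairs 1"
  unfolding coprime_pairs_iff[OF zero_less_one] using det_neq_0_ker[OF assms] by (simp add: hom_eval_1)

lemma mob_hpt:
  assumes "\<alpha> * \<delta> - \<beta> * \<gamma> \<noteq> 0" "X \<noteq> 0 \<or> Y \<noteq> 0"
  shows "mob \<alpha> \<beta> \<gamma> \<delta> (hpt X Y) = hpt (\<alpha> * X + \<beta> * Y) (\<gamma> * X + \<delta> * Y)"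
  unfolding mob_def ratmap_hpt[OF mob_pair[OF assms(1)] assms(2)] by (simp add: hom_eval_1)

lemma rational_maps_1: "rational_maps 1 = {mob \<alpha> \<beta> \<gamma> \<delta> |\<alpha> \<beta> \<gamma> \<delta>. \<alpha> * \<delta> - \<beta> * \<gamma> \<noteq> 0}"
proof (intro equalityI subsetI)
  fix f assume "f \<in> rational_maps 1"
  then obtain p q where pq: "(p, q) \<in> coprime_pairs 1" "f = ratmap (p, q)" by (auto simp: rational_maps_def)
  from pq(1)[unfolded coprime_pairs_iff[OF zero_less_one]] have deg: "degree p \<le> 1" "degree q \<le> 1"
    and nz: "\<And>X Y. X \<noteq> 0 \<or> Y \<noteq> 0 \<Longrightarrow> hom_eval 1 p X Y \<noteq> 0 \<or> hom_eval 1 q X Y \<noteq> 0" by blast+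
  have lin: "\<exists>x y. r = [:y, x:]" if "degree r \<le> 1" for r :: "complex poly"
    using that by (cases r rule: pCons_cases) (metis degree_eq_zeroE degree_pCons_eq_if le_zero_eq nat_add_left_cancel_le One_nat_def Suc_le_mono pCons_0_0)
  obtain \<alpha> \<beta> where p: "p = [:\<beta>, \<alpha>:]" using lin[OF deg(1)] by blast
  obtain \<gamma> \<delta> where q: "q = [:\<delta>, \<gamma>:]" using lin[OF deg(2)] by blast
  have "\<alpha> * \<delta> - \<beta> * \<gamma> \<noteq> 0"
  proof
    assume "\<alpha> * \<delta> - \<beta> * \<gamma> = 0"
    \<comment> \<open>With determinant zero, (-\<beta>, \<alpha>) and (-\<delta>, \<gamma>)
      annihilate both forms; if both vectors are zero, so are the forms, and (1, 0) serves.\<close>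
    then show False using nz[of "- \<beta>" \<alpha>] nz[of "- \<delta>" \<gamma>] nz[of 1 0] by (auto simp: p q hom_eval_1 algebra_simps)
  qed
  then show "f \<in> {mob \<alpha> \<beta> \<gamma> \<delta> |\<alpha> \<beta> \<gamma> \<delta>. \<alpha> * \<delta> - \<beta> * \<gamma> \<noteq> 0}" using pq(2) p q by (auto simp: mob_def)
next
  fix f assume "f \<in> {mob \<alpha> \<beta> \<gamma> \<delta> |\<alpha> \<beta> \<gamma> \<delta>. \<alpha> * \<delta> - \<beta> * \<gamma> \<noteq> 0}"
  then show "f \<in> rational_maps 1" using mob_pair unfolding mob_def rational_maps_def by blast
qed

lemma mob_comp:
  assumes "\<alpha> * \<delta> - \<beta> * \<gamma> \<noteq> 0" "a * d - b * c \<noteq> 0"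
  shows "mob \<alpha> \<beta> \<gamma> \<delta> \<circ> mob a b c d = mob (\<alpha> * a + \<beta> * c) (\<alpha> * b + \<beta> * d) (\<gamma> * a + \<delta> * c) (\<gamma> * b + \<delta> * d)"
    and "(\<alpha> * a + \<beta> * c) * (\<gamma> * b + \<delta> * d) - (\<alpha> * b + \<beta> * d) * (\<gamma> * a + \<delta> * c) \<noteq> 0"
proof -
  have "(\<alpha> * a + \<beta> * c) * (\<gamma> * b + \<delta> * d) - (\<alpha> * b + \<beta> * d) * (\<gamma> * a + \<delta> * c) =
      (\<alpha> * \<delta> - \<beta> * \<gamma>) * (a * d - b * c)" by (simp add: algebra_simps)
  then show det: "(\<alpha> * a + \<beta> * c) * (\<gamma> * b + \<delta> * d) - (\<alpha> * b + \<beta> * d) * (\<gamma> * a + \<delta> * c) \<noteq> 0" using assms by simp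
  show "mob \<alpha> \<beta> \<gamma> \<delta> \<circ> mob a b c d = mob (\<alpha> * a + \<beta> * c) (\<alpha> * b + \<beta> * d) (\<gamma> * a + \<delta> * c) (\<gamma> * b + \<delta> * d)"
  proof
    fix x
    obtain X Y where x: "x = hpt X Y" and nz: "X \<noteq> 0 \<or> Y \<noteq> 0" by (rule hpt_cases)
    show "(mob \<alpha> \<beta> \<gamma> \<delta> \<circ> mob a b c d) x = mob (\<alpha> * a + \<beta> * c) (\<alpha> * b + \<beta> * d) (\<gamma> * a + \<delta> * c) (\<gamma> * b + \<delta> * d) x"
      by (simp add: x mob_hpt[OF assms(2) nz] mob_hpt[OF assms(1) det_neq_0_ker[OF assms(2) nz]] mob_hpt[OF det nz])
         (simp add: algebra_simps)
  qed
qed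

lemma mob_scalar: "k \<noteq> 0 \<Longrightarrow> mob k 0 0 k = id"
proof
  fix x assume k: "k \<noteq> 0"
  obtain X Y where x: "x = hpt X Y" and nz: "X \<noteq> 0 \<or> Y \<noteq> 0" by (rule hpt_cases)
  show "mob k 0 0 k x = id x" unfolding x using k nz by (subst mob_hpt) (simp_all add: hpt_scale)
qed

lemma mob_inverse:
  assumes "\<alpha> * \<delta> - \<beta> * \<gamma> \<noteq> 0"
  shows "mob \<delta> (- \<beta>) (- \<gamma>) \<alpha> \<circ> mob \<alpha> \<beta> \<gamma> \<delta> = id" "mob \<alpha> \<beta> \<gamma> \<delta> \<circ> mob \<delta> (- \<beta>) (- \<gamma>) \<alpha> = id"
proof -
  have d: "\<delta> * \<alpha> - (- \<beta>) * (- \<gamma>) \<noteq> 0" using assms by (simp add: algebra_simps)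
  have "mob \<delta> (- \<beta>) (- \<gamma>) \<alpha> \<circ> mob \<alpha> \<beta> \<gamma> \<delta> = mob (\<alpha> * \<delta> - \<beta> * \<gamma>) 0 0 (\<alpha> * \<delta> - \<beta> * \<gamma>)"
    unfolding mob_comp(1)[OF d assms] by (simp add: algebra_simps)
  then show "mob \<delta> (- \<beta>) (- \<gamma>) \<alpha> \<circ> mob \<alpha> \<beta> \<gamma> \<delta> = id" using mob_scalar[OF assms] by simp
  have "mob \<alpha> \<beta> \<gamma> \<delta> \<circ> mob \<delta> (- \<beta>) (- \<gamma>) \<alpha> = mob (\<alpha> * \<delta> - \<beta> * \<gamma>) 0 0 (\<alpha> * \<delta> - \<beta> * \<gamma>)"
    unfolding mob_comp(1)[OF assms d] by (simp add: algebra_simps)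
  then show "mob \<alpha> \<beta> \<gamma> \<delta> \<circ> mob \<delta> (- \<beta>) (- \<gamma>) \<alpha> = id" using mob_scalar[OF assms] by simp
qed

lemma rational_maps_1_group:
  "id \<in> rational_maps 1"
  "\<mu> \<in> rational_maps 1 \<Longrightarrow> \<nu> \<in> rational_maps 1 \<Longrightarrow> \<mu> \<circ> \<nu> \<in> rational_maps 1"
  "\<mu> \<in> rational_maps 1 \<Longrightarrow> \<exists>\<nu>\<in>rational_maps 1. \<mu> \<circ> \<nu> = id \<and> \<nu> \<circ> \<mu> = id"
proof -
  have "mob 1 0 0 1 \<in> rational_maps 1" unfolding rational_maps_1 by (rule CollectI) (metis mult_1 diff_zero mult_zero_left zero_neq_one)
  then show "id \<in> rational_maps 1" by (simp add: mob_scalar)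
  show "\<mu> \<circ> \<nu> \<in> rational_maps 1" if "\<mu> \<in> rational_maps 1" "\<nu> \<in> rational_maps 1"
    using that mob_comp unfolding rational_maps_1 by fast
  show "\<exists>\<nu>\<in>rational_maps 1. \<mu> \<circ> \<nu> = id \<and> \<nu> \<circ> \<mu> = id" if \<mu>: "\<mu> \<in> rational_maps 1"
  proof -
    obtain \<alpha> \<beta> \<gamma> \<delta> where m: "\<mu> = mob \<alpha> \<beta> \<gamma> \<delta>" "\<alpha> * \<delta> - \<beta> * \<gamma> \<noteq> 0" using \<mu> unfolding rational_maps_1 by blast
    have "\<delta> * \<alpha> - (- \<beta>) * (- \<gamma>) \<noteq> 0" using m(2) by (simp add: algebra_simps)
    then have "mob \<delta> (- \<beta>) (- \<gamma>) \<alpha> \<in> rational_maps 1" unfolding rational_maps_1 by blast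
    then show ?thesis using mob_inverse[OF m(2)] m(1) by blast
  qed
qed

text \<open>Invertible linear changes of variables and of values keep two binary forms free of
  common zeros; \<open>sub\<close> carries out the change of variables.\<close>

lemma rational_maps_2_comp:
  assumes f: "f \<in> rational_maps 2" and \<mu>: "\<mu> \<in> rational_maps 1" and \<nu>: "\<nu> \<in> rational_maps 1"
  shows "\<mu> \<circ> f \<circ> \<nu> \<in> rational_maps 2"
proof -
  obtain p q where pq: "(p, q) \<in> coprime_pairs 2" "f = ratmap (p, q)" using f by (auto simp: rational_maps_def)
  obtain \<alpha> \<beta> \<gamma> \<delta> where m: "\<mu> = mob \<alpha> \<beta> \<gamma> \<delta>" "\<alpha> * \<delta> - \<beta> * \<gamma> \<noteq> 0" using \<mu> unfolding rational_maps_1 by blast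
  obtain a b c d where n: "\<nu> = mob a b c d" "a * d - b * c \<noteq> 0" using \<nu> unfolding rational_maps_1 by blast
  define sub where "sub p = [:coeff p 0 * d\<^sup>2 + coeff p 1 * b * d + coeff p 2 * b\<^sup>2,
    2 * coeff p 0 * c * d + coeff p 1 * (a * d + b * c) + 2 * coeff p 2 * a * b,
    coeff p 0 * c\<^sup>2 + coeff p 1 * a * c + coeff p 2 * a\<^sup>2:]" for p
  have sub: "hom_eval 2 (smult x (sub p) + smult y (sub q)) X Y =
     x * hom_eval 2 p (a * X + b * Y) (c * X + d * Y) + y * hom_eval 2 q (a * X + b * Y) (c * X + d * Y)" for p q x y X Y
    unfolding hom_eval_2 by (simp add: sub_def numeral_2_eq_2) (simp add: algebra_simps power2_eq_square)
  have degsub: "degree (smult x (sub p) + smult y (sub q)) \<le> 2" for x y p q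
    by (intro degree_add_le degree_smult_le[THEN order_trans]) (simp_all add: sub_def)
  let ?p = "smult \<alpha> (sub p) + smult \<beta> (sub q)" and ?q = "smult \<gamma> (sub p) + smult \<delta> (sub q)"
  note nz2 = pq(1)[unfolded coprime_pairs_iff[OF zero_less_numeral], THEN conjunct2, THEN conjunct2, rule_format]
  have "(?p, ?q) \<in> coprime_pairs 2"
    unfolding coprime_pairs_iff[OF zero_less_numeral] sub
    using degsub det_neq_0_ker[OF m(2) nz2[OF det_neq_0_ker[OF n(2)]]] by blast
  moreover have "\<mu> \<circ> f \<circ> \<nu> = ratmap (?p, ?q)"
  proof
    fix x
    obtain X Y where x: "x = hpt X Y" and nz: "X \<noteq> 0 \<or> Y \<noteq> 0" by (rule hpt_cases)
    note nz' = det_neq_0_ker[OF n(2) nz]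
    show "(\<mu> \<circ> f \<circ> \<nu>) x = ratmap (?p, ?q) x"
      unfolding x ratmap_hpt[OF \<open>(?p, ?q) \<in> coprime_pairs 2\<close> nz] sub
      by (simp add: m(1) n(1) pq(2) mob_hpt[OF n(2) nz] ratmap_hpt[OF pq(1) nz'] mob_hpt[OF m(2) nz2[OF nz']])
  qed
  ultimately show ?thesis unfolding rational_maps_def by blast
qed

lemma equiv_conj_rel: "equiv (rational_maps 2) conj_rel"
proof (rule equivI)
  show "conj_rel \<subseteq> rational_maps 2 \<times> rational_maps 2" by (auto simp: conj_rel_def)
  show "refl_on (rational_maps 2) conj_rel"
    using rational_maps_1_group(1) by (auto simp: refl_on_def conj_rel_def intro!: bexI[of _ id])
  show "sym conj_rel"
  proof (rule symI)
    fix f g assume "(f, g) \<in> conj_rel"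
    then obtain \<mu> where fg: "f \<in> rational_maps 2" "g \<in> rational_maps 2" "\<mu> \<in> rational_maps 1" "\<mu> \<circ> f = g \<circ> \<mu>"
      by (auto simp: conj_rel_def)
    obtain \<nu> where \<nu>: "\<nu> \<in> rational_maps 1" "\<mu> \<circ> \<nu> = id" "\<nu> \<circ> \<mu> = id" using rational_maps_1_group(3)[OF fg(3)] by blast
    have "\<nu> \<circ> g = f \<circ> \<nu>" using fg(4) \<nu>(2,3) by (metis comp_assoc comp_id id_comp)
    then show "(g, f) \<in> conj_rel" using fg \<nu>(1) by (auto simp: conj_rel_def)
  qed
  show "trans conj_rel"
  proof (rule transI)
    fix f g h assume "(f, g) \<in> conj_rel" "(g, h) \<in> conj_rel"
    then obtain \<mu> \<nu> where fg: "f \<in> rational_maps 2" "h \<in> rational_maps 2" "\<mu> \<in> rational_maps 1" "\<mu> \<circ> f = g \<circ> \<mu>"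
      "\<nu> \<in> rational_maps 1" "\<nu> \<circ> g = h \<circ> \<nu>"
      by (auto simp: conj_rel_def)
    then have "(\<nu> \<circ> \<mu>) \<circ> f = h \<circ> (\<nu> \<circ> \<mu>)" by (metis comp_assoc)
    then show "(f, h) \<in> conj_rel" using fg rational_maps_1_group(2) by (auto simp: conj_rel_def)
  qed
qed

subsection \<open>Critical points, normal form and irreducibility\<close>

lemma quotient_derivative_0:
  fixes p q :: "complex poly"
  assumes "((\<lambda>t. poly p t / poly q t) has_field_derivative 0) (at z)" "poly q z \<noteq> 0"
  shows "poly (pderiv p) z * poly q z = poly p z * poly (pderiv q) z"
proof -
  have "((\<lambda>t. poly p t / poly q t) has_field_derivative
    (poly (pderiv p) z * poly q z - poly p z * poly (pderiv q) z) / (poly q z * poly q z)) (at z)"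
    by (rule DERIV_divide[OF poly_DERIV poly_DERIV assms(2)])
  with assms show ?thesis by (auto dest: DERIV_unique)
qed

lemma poly_quadratic:
  fixes p :: "complex poly"
  assumes "degree p \<le> 2"
  shows "poly p z = coeff p 0 + coeff p 1 * z + coeff p 2 * z\<^sup>2"
proof -
  have "hom_eval 2 p z 1 = poly p z" using hom_eval_nz[OF assms, of 1 z] by simp
  then show ?thesis by (simp add: hom_eval_2)
qed

lemma poly_pderiv_quadratic:
  fixes p :: "complex poly"
  assumes "degree p \<le> 2"
  shows "poly (pderiv p) z = coeff p 1 + 2 * coeff p 2 * z"
proof -
  have "p = [:coeff p 0, coeff p 1, coeff p 2:]"
    using assms by (intro poly_eqI) (auto simp: coeff_pCons numeral_2_eq_2 coeff_eq_0 split: nat.splits)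
  then have "poly (pderiv p) z = poly (pderiv [:coeff p 0, coeff p 1, coeff p 2:]) z"
    by (rule arg_cong)
  also have "\<dots> = coeff p 1 + 2 * coeff p 2 * z"
    by (simp add: pderiv_pCons)
  finally show ?thesis .
qed

text \<open>This is the vanishing of the Wronskian, which is symmetric in \<open>p\<close> and
  \<open>q\<close> up to sign; at a pole, \<open>coord\<close> replaces \<open>p / q\<close> by
  \<open>q / p\<close>.\<close>

lemma critical_point_Aff:
  assumes pq: "(p, q) \<in> coprime_pairs 2" and crit: "critical_point (ratmap (p, q)) (Aff z)"
  shows "poly (pderiv p) z * poly q z = poly p z * poly (pderiv q) z"
proof (cases "poly q z = 0")
  case True
  have "poly p z \<noteq> 0"
    using pq[unfolded coprime_pairs_iff[OF zero_less_numeral]] True hom_eval_nz[of p 2 1 z] hom_eval_nz[of q 2 1 z] by force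
  moreover have "(\<lambda>t. coord (ratmap (p, q) (Aff z)) (ratmap (p, q) (param (Aff z) t))) = (\<lambda>t. poly q t / poly p t)"
    using True by auto
  ultimately show ?thesis
    using crit quotient_derivative_0[of q p z] unfolding critical_point_def by (simp add: mult.commute)
next
  case False
  then have "(\<lambda>t. coord (ratmap (p, q) (Aff z)) (ratmap (p, q) (param (Aff z) t))) = (\<lambda>t. poly p t / poly q t)"
    by auto
  then show ?thesis
    using crit False quotient_derivative_0[of p q z] unfolding critical_point_def by simp
qed

text \<open>In the coordinate 1 / z the coefficients are reversed, and the condition is the
  vanishing of the Wronskian at 0.\<close>

lemma critical_point_Infty:
  assumes pq: "(p, q) \<in> coprime_pairs 2" and crit: "critical_point (ratmap (p, q)) Infty"
  shows "coeff p 1 * coeff q 2 = coeff p 2 * coeff q 1"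
proof -
  let ?r = "\<lambda>p. [:coeff p 2, coeff p 1, coeff p 0:]"
  have max: "max (degree p) (degree q) = 2" using pq by (simp add: coprime_pairs_def)
  then have deg: "degree p \<le> 2" "degree q \<le> 2" by auto
  have r: "poly p (inverse t) = poly (?r p) t / t\<^sup>2" if "t \<noteq> 0" "degree p \<le> 2" for p :: "complex poly" and t
  proof -
    have "x + y * inverse t + z * (inverse t)\<^sup>2 = (z + t * (y + t * x)) / t\<^sup>2" for x y z
      using that(1) by (simp add: inverse_eq_divide power2_eq_square add_divide_distrib distrib_left)
    then show ?thesis unfolding poly_quadratic[OF that(2)] by simp
  qed
  have nz: "coeff p 2 \<noteq> 0 \<or> coeff q 2 \<noteq> 0"
    using pq[unfolded coprime_pairs_iff[OF zero_less_numeral], THEN conjunct2, THEN conjunct2, rule_format, of 1 0]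
    by (simp add: hom_eval_0)
  have val: "ratmap (p, q) (param Infty t) = (if poly (?r q) t = 0 then Infty else Aff (poly (?r p) t / poly (?r q) t))" for t
  proof (cases "t = 0")
    case False
    then show ?thesis using r[OF False deg(1)] r[OF False deg(2)] by (simp del: poly_pCons)
  qed (simp add: max Let_def)
  show ?thesis
  proof (cases "coeff q 2 = 0")
    case True
    have "(\<lambda>t. coord (ratmap (p, q) Infty) (ratmap (p, q) (param Infty t))) = (\<lambda>t. poly (?r q) t / poly (?r p) t)"
      using True max unfolding val by (auto simp: Let_def)
    then show ?thesis
      using crit True nz quotient_derivative_0[of "?r q" "?r p" 0] unfolding critical_point_def
      by (simp add: pderiv_pCons)
  next
    case False
    have "(\<lambda>t. coord (ratmap (p, q) Infty) (ratmap (p, q) (param Infty t))) = (\<lambda>t. poly (?r p) t / poly (?r q) t)"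
      using False max unfolding val by (auto simp: Let_def)
    then show ?thesis
      using crit False quotient_derivative_0[of "?r p" "?r q" 0] unfolding critical_point_def
      by (simp add: pderiv_pCons)
  qed
qed

lemma quadratic_form_root:
  assumes "degree p \<le> 2"
  obtains X Y where "X \<noteq> 0 \<or> Y \<noteq> 0" "hom_eval 2 p X Y = 0"
proof (cases "coeff p 2 = 0")
  case True
  then show ?thesis using that[of 1 0] by (simp add: hom_eval_0)
next
  case False
  then have "degree p \<noteq> 0" using le_degree[of p 2] by auto
  then obtain z where "poly p z = 0" using fundamental_theorem_of_algebra[of p] by (auto simp: constant_degree)
  then show ?thesis using that[of z 1] hom_eval_nz[OF assms, of 1 z] by simp
qed

text \<open>
  The fibre through \<open>x\<close> is the zero set of the quadratic form \<open>Q p - P q\<close>, where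
  \<open>f x = [P : Q]\<close>, and criticality makes \<open>x\<close> a double zero.
\<close>

lemma critical_point_unique_preimage:
  assumes f: "f \<in> rational_maps 2" and crit: "critical_point f x" and eq: "f y = f x"
  shows "y = x"
proof -
  obtain p q where pq: "(p, q) \<in> coprime_pairs 2" "f = ratmap (p, q)" using f by (auto simp: rational_maps_def)
  have deg: "degree p \<le> 2" "degree q \<le> 2" using pq(1) by (auto simp: coprime_pairs_def)
  note nz = pq(1)[unfolded coprime_pairs_iff[OF zero_less_numeral], THEN conjunct2, THEN conjunct2, rule_format]
  note val = ratmap_hpt[OF pq(1)]
  define X Y where "X = (case x of Aff z \<Rightarrow> z | Infty \<Rightarrow> 1)" and "Y = (case x of Aff z \<Rightarrow> 1 | Infty \<Rightarrow> (0::complex))"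
  have x: "x = hpt X Y" and XY: "X \<noteq> 0 \<or> Y \<noteq> 0" by (auto simp: X_def Y_def hpt_def split: proj_line.splits)
  define P Q where "P = hom_eval 2 p X Y" and "Q = hom_eval 2 q X Y"
  have PQ: "P \<noteq> 0 \<or> Q \<noteq> 0" using nz[OF XY] by (simp add: P_def Q_def)
  define r where "r = smult Q p - smult P q"
  have degr: "degree r \<le> 2" unfolding r_def using deg by (intro degree_diff_le degree_smult_le[THEN order_trans])
  have hr: "hom_eval 2 r X' Y' = Q * hom_eval 2 p X' Y' - P * hom_eval 2 q X' Y'" for X' Y'
    unfolding hom_eval_2 r_def by (simp add: algebra_simps)
  have fibre: "f (hpt X' Y') = f x \<longleftrightarrow> hom_eval 2 r X' Y' = 0" if "X' \<noteq> 0 \<or> Y' \<noteq> 0" for X' Y'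
    unfolding x pq(2) val[OF that] val[OF XY] P_def[symmetric] Q_def[symmetric] hpt_eq_iff[OF nz[OF that] PQ] hr
    by (auto simp: mult.commute)
  \<comment> \<open>Otherwise \<open>f\<close> would be constant, but zeros of the two forms yield
    the values \<open>Infty\<close> and \<open>Aff 0\<close>.\<close>
  have r0: "r \<noteq> 0"
  proof
    assume "r = 0"
    then have const: "f (hpt X' Y') = f x" if "X' \<noteq> 0 \<or> Y' \<noteq> 0" for X' Y' using fibre[OF that] by (simp add: hom_eval_def)
    obtain a b where ab: "a \<noteq> 0 \<or> b \<noteq> 0" "hom_eval 2 q a b = 0" by (rule quadratic_form_root[OF deg(2)])
    obtain c d where cd: "c \<noteq> 0 \<or> d \<noteq> 0" "hom_eval 2 p c d = 0" by (rule quadratic_form_root[OF deg(1)])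
    have "f (hpt a b) = Infty" unfolding pq(2) val[OF ab(1)] by (simp add: ab(2) hpt_def)
    moreover have "f (hpt c d) = Aff 0"
      unfolding pq(2) val[OF cd(1)] using cd(2) nz[OF cd(1)] by (simp add: hpt_def)
    ultimately show False using const[OF ab(1)] const[OF cd(1)] by simp
  qed
  have rc: "r = [:coeff r 0, coeff r 1, coeff r 2:]"
    using degr by (intro poly_eqI) (auto simp: coeff_pCons numeral_2_eq_2 coeff_eq_0 split: nat.splits)
  obtain X' Y' where y: "y = hpt X' Y'" and XY': "X' \<noteq> 0 \<or> Y' \<noteq> 0" by (rule hpt_cases)
  have ry: "hom_eval 2 r X' Y' = 0" using fibre[OF XY'] eq y by simp
  show "y = x"
  proof (cases x)
    case (Aff z)
    have XYz: "X = z" "Y = 1" by (simp_all add: X_def Y_def Aff)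
    have hz: "hom_eval 2 s z 1 = poly s z" if "degree s \<le> 2" for s using hom_eval_nz[OF that, of 1 z] by simp
    have PQz: "P = poly p z" "Q = poly q z" by (simp_all add: P_def Q_def XYz hz deg)
    have "poly r z = 0" by (simp add: r_def PQz)
    then have v0: "coeff r 0 + coeff r 1 * z + coeff r 2 * z\<^sup>2 = 0" by (simp add: poly_quadratic[OF degr])
    have "poly (pderiv r) z = 0"
      using critical_point_Aff[OF pq(1)] crit by (simp add: pq(2) Aff r_def PQz pderiv_diff pderiv_smult mult.commute)
    then have v1: "coeff r 1 + 2 * coeff r 2 * z = 0" by (simp add: poly_pderiv_quadratic[OF degr])
    have c1: "coeff r 1 = - 2 * coeff r 2 * z" using v1 by (simp add: add_eq_0_iff)
    have "coeff r 0 = coeff r 2 * z\<^sup>2"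
      using v0 unfolding c1 by (simp add: algebra_simps power2_eq_square add_eq_0_iff)
    then have "hom_eval 2 r X' Y' = coeff r 2 * (X' - z * Y')\<^sup>2"
      unfolding hom_eval_2 c1 by (simp add: algebra_simps power2_eq_square)
    moreover have "coeff r 2 \<noteq> 0" using rc r0 v0 c1 by (metis add.right_neutral mult_zero_left mult_zero_right pCons_0_0)
    ultimately have "X' = z * Y'" using ry by simp
    then show ?thesis using XY' by (auto simp: y Aff hpt_def)
  next
    case Infty
    have PQ2: "P = coeff p 2" "Q = coeff q 2" by (simp_all add: P_def Q_def X_def Y_def Infty hom_eval_0)
    have "coeff r 2 = 0" by (simp add: r_def PQ2)
    moreover have "coeff r 1 = 0"
      using critical_point_Infty[OF pq(1)] crit by (simp add: pq(2) Infty r_def PQ2 mult.commute)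
    ultimately have "coeff r 0 \<noteq> 0" "hom_eval 2 r X' Y' = coeff r 0 * Y'\<^sup>2" using rc r0 by (auto simp: hom_eval_2)
    then show ?thesis using ry by (simp add: y Infty hpt_def)
  qed
qed

section \<open>The normal form and its orbit of 0\<close>

definition norm_pair :: "complex \<Rightarrow> complex \<Rightarrow> complex poly \<times> complex poly" where
  "norm_pair b c = ([:c, b, 1:], [:0, 0, 1:])"

lemma norm_pair_coprime: "c \<noteq> 0 \<Longrightarrow> norm_pair b c \<in> coprime_pairs 2"
  unfolding norm_pair_def coprime_pairs_iff[OF zero_less_numeral] hom_eval_2 by (auto simp: numeral_2_eq_2)

lemma norm_pair_hpt:
  assumes "c \<noteq> 0" "X \<noteq> 0 \<or> Y \<noteq> 0"
  shows "ratmap (norm_pair b c) (hpt X Y) = hpt (X\<^sup>2 + b * X * Y + c * Y\<^sup>2) (X\<^sup>2)"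
  using ratmap_hpt[OF norm_pair_coprime[OF assms(1), of b, unfolded norm_pair_def] assms(2)]
  unfolding norm_pair_def hom_eval_2 by (simp add: numeral_2_eq_2 add_ac)

text \<open>As c is nonzero, two consecutive zeros would propagate back to
  \<open>A\<^sub>1 = 1\<close>. Hence the coordinates in \<open>norm_pair_orbit\<close> are never
  both zero.\<close>

lemma orb_num_consecutive:
  fixes b c :: complex
  assumes "c \<noteq> 0"
  shows "orb_num b c (Suc k) \<noteq> 0 \<or> orb_num b c k \<noteq> 0"
  using assms by (induction k) auto

text \<open>With X the current numerator and Y the square of the previous one,
  \<open>norm_pair_hpt\<close> is exactly the recursion of \<open>orb_num\<close>.\<close>

lemma norm_pair_orbit:
  assumes "c \<noteq> 0"
  shows "(ratmap (norm_pair b c) ^^ Suc k) (Aff 0) = hpt (orb_num b c (Suc k)) ((orb_num b c k)\<^sup>2)"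
proof (induction k)
  case 0
  show ?case using norm_pair_hpt[OF assms, of 0 1 b] by (simp add: hpt_def)
next
  case (Suc k)
  have "orb_num b c (Suc k) \<noteq> 0 \<or> (orb_num b c k)\<^sup>2 \<noteq> 0" using orb_num_consecutive[OF assms, of b k] by simp
  from norm_pair_hpt[OF assms this, of b] Suc show ?case
    by (simp add: power_mult[symmetric] flip: power_mult)
qed

lemma norm_pair_orbit_eq_0_iff:
  assumes "c \<noteq> 0" "m > 0"
  shows "(ratmap (norm_pair b c) ^^ m) (Aff 0) = Aff 0 \<longleftrightarrow> orb_num b c m = 0"
proof -
  obtain k where k: "m = Suc k" using assms(2) gr0_implies_Suc by blast
  show ?thesis unfolding k norm_pair_orbit[OF assms(1)]
    using orb_num_consecutive[OF assms(1), of b k] by (auto simp: hpt_def)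
qed

lemma norm_pair_exact_period:
  assumes "c \<noteq> 0" "n > 0"
  shows "has_exact_period (ratmap (norm_pair b c)) n (Aff 0) \<longleftrightarrow> (b, c) \<in> per_params n"
  using assms by (auto simp: has_exact_period_def per_params_def norm_pair_orbit_eq_0_iff)

lemma norm_pair_critical:
  assumes "c \<noteq> 0"
  shows "critical_point (ratmap (norm_pair b c)) (Aff 0)"
proof -
  have eq: "(\<lambda>t. coord (ratmap (norm_pair b c) (Aff 0)) (ratmap (norm_pair b c) (param (Aff 0) t)))
    = (\<lambda>t. t\<^sup>2 / (t\<^sup>2 + b * t + c))"
    by (auto simp: norm_pair_def power2_eq_square algebra_simps)
  have "((\<lambda>t. t\<^sup>2 / (t\<^sup>2 + b * t + c)) has_field_derivative 0) (at 0)"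
    using assms by (auto intro!: derivative_eq_intros)
  then show ?thesis unfolding critical_point_def eq by simp
qed

text \<open>The cross-ratio in homogeneous coordinates; \<open>u\<close>, \<open>v\<close>,
  \<open>w\<close> are nonzero because the points are distinct.\<close>

lemma mob_three_points:
  assumes "x0 \<noteq> x1" "x0 \<noteq> x2" "x1 \<noteq> x2"
  obtains \<mu> where "\<mu> \<in> rational_maps 1" "\<mu> x0 = Aff 0" "\<mu> x1 = Infty" "\<mu> x2 = Aff 1"
proof -
  obtain X0 Y0 where x0: "x0 = hpt X0 Y0" "X0 \<noteq> 0 \<or> Y0 \<noteq> 0" by (rule hpt_cases)
  obtain X1 Y1 where x1: "x1 = hpt X1 Y1" "X1 \<noteq> 0 \<or> Y1 \<noteq> 0" by (rule hpt_cases)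
  obtain X2 Y2 where x2: "x2 = hpt X2 Y2" "X2 \<noteq> 0 \<or> Y2 \<noteq> 0" by (rule hpt_cases)
  define u v w where "u = X2 * Y1 - X1 * Y2" and "v = X2 * Y0 - X0 * Y2" and "w = X1 * Y0 - X0 * Y1"
  have nz: "u \<noteq> 0" "v \<noteq> 0" "w \<noteq> 0"
    using assms unfolding x0(1) x1(1) x2(1) hpt_eq_iff[OF x0(2) x1(2)] hpt_eq_iff[OF x0(2) x2(2)] hpt_eq_iff[OF x1(2) x2(2)]
    by (auto simp: u_def v_def w_def)
  have "(u * Y0) * (- (v * X1)) - (- (u * X0)) * (v * Y1) = - (u * v * w)" by (simp add: w_def algebra_simps)
  then have det: "(u * Y0) * (- (v * X1)) - (- (u * X0)) * (v * Y1) \<noteq> 0" using nz by simp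
  let ?\<mu> = "mob (u * Y0) (- (u * X0)) (v * Y1) (- (v * X1))"
  have img: "?\<mu> (hpt X Y) = hpt (u * (X * Y0 - X0 * Y)) (v * (X * Y1 - X1 * Y))" if "X \<noteq> 0 \<or> Y \<noteq> 0" for X Y
    unfolding mob_hpt[OF det that] by (simp add: algebra_simps)
  have "?\<mu> x0 = Aff 0" unfolding x0(1) img[OF x0(2)] using nz by (auto simp: hpt_def w_def mult.commute)
  moreover have "?\<mu> x1 = Infty" unfolding x1(1) img[OF x1(2)] by (simp add: hpt_def)
  moreover have "?\<mu> x2 = Aff 1" unfolding x2(1) img[OF x2(2)] u_def[symmetric] v_def[symmetric]
    using nz by (simp add: hpt_def)
  moreover have "?\<mu> \<in> rational_maps 1" unfolding rational_maps_1 using det by blast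
  ultimately show ?thesis using that by blast
qed

text \<open>As 0 is the only pole, the denominator is \<open>\<kappa>\<close> times
  \<open>z\<^sup>2\<close>; the value 1 at infinity gives the numerator the same leading
  coefficient, which is divided out.\<close>

lemma normal_form:
  assumes g: "g \<in> rational_maps 2" "g (Aff 0) = Infty" "g Infty = Aff 1"
    and uniq: "\<And>y. g y = Infty \<Longrightarrow> y = Aff 0"
  obtains b c where "c \<noteq> 0" "g = ratmap (norm_pair b c)"
proof -
  obtain p q where pq: "(p, q) \<in> coprime_pairs 2" "g = ratmap (p, q)" using g(1) by (auto simp: rational_maps_def)
  have max: "max (degree p) (degree q) = 2" using pq(1) by (simp add: coprime_pairs_def)
  then have deg: "degree p \<le> 2" "degree q \<le> 2" by auto
  define \<kappa> where "\<kappa> = coeff q 2"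
  have \<kappa>: "\<kappa> \<noteq> 0" "coeff p 2 = \<kappa>"
    using g(3) max unfolding pq(2) by (auto simp: \<kappa>_def Let_def split: if_splits)
  have "poly q 0 = 0" using g(2) unfolding pq(2) by (auto split: if_splits)
  then have q0: "coeff q 0 = 0" by (simp add: poly_0_coeff_0)
  have q1: "coeff q 1 = 0"
  proof -
    \<comment> \<open>The root of the second linear factor of \<open>q\<close> is also a pole, hence
      0.\<close>
    have "poly q (- (coeff q 1 / \<kappa>)) = 0"
      using \<kappa>(1) q0 by (simp add: poly_quadratic[OF deg(2)] \<kappa>_def[symmetric] field_simps power2_eq_square)
    then have "g (Aff (- (coeff q 1 / \<kappa>))) = Infty" by (simp add: pq(2))
    from uniq[OF this] show ?thesis using \<kappa>(1) by simp
  qed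
  have p0: "coeff p 0 \<noteq> 0"
    using pq(1)[unfolded coprime_pairs_iff[OF zero_less_numeral], THEN conjunct2, THEN conjunct2, rule_format, of 0 1] q0
    by (simp add: hom_eval_2)
  define b c where "b = coeff p 1 / \<kappa>" and "c = coeff p 0 / \<kappa>"
  have c: "c \<noteq> 0" using p0 \<kappa> by (simp add: c_def)
  have "g = ratmap (norm_pair b c)"
  proof
    fix x
    obtain X Y where x: "x = hpt X Y" and nz: "X \<noteq> 0 \<or> Y \<noteq> 0" by (rule hpt_cases)
    have "hom_eval 2 p X Y = \<kappa> * (X\<^sup>2 + b * X * Y + c * Y\<^sup>2)" "hom_eval 2 q X Y = \<kappa> * X\<^sup>2"
      using \<kappa> q0 q1 by (simp_all add: hom_eval_2 b_def c_def \<kappa>_def[symmetric] algebra_simps)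
    then show "g x = ratmap (norm_pair b c) x"
      unfolding x norm_pair_hpt[OF c nz] pq(2) ratmap_hpt[OF pq(1) nz] using hpt_scale[OF \<kappa>(1)] by simp
  qed
  then show ?thesis using that c by blast
qed

text \<open>For n at least 3, the periodic critical point and its next two iterates are distinct and
  can be moved to 0, \<infinity> and 1. By \<open>critical_point_unique_preimage\<close>, 0 is then
  the only pole, as \<open>normal_form\<close> requires.\<close>

lemma Per_zero_eq:
  assumes n: "n \<ge> 3"
  shows "Per_zero n = (\<lambda>(b, c). conj_class_of_pair (norm_pair b c)) ` per_params n"
proof (intro equalityI subsetI)
  fix C assume "C \<in> (\<lambda>(b, c). conj_class_of_pair (norm_pair b c)) ` per_params n"
  then obtain b c where bc: "(b, c) \<in> per_params n" "C = conj_class_of_pair (norm_pair b c)" by auto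
  have c: "c \<noteq> 0" using bc(1) by (simp add: per_params_def)
  let ?N = "ratmap (norm_pair b c)"
  have "?N \<in> rational_maps 2" using norm_pair_coprime[OF c] by (auto simp: rational_maps_def)
  then have "?N \<in> C" unfolding bc(2) conj_class_of_pair_def by (rule equiv_class_self[OF equiv_conj_rel])
  moreover have "C \<in> M2" using conj_class_of_pair_image norm_pair_coprime[OF c] bc(2) by blast
  moreover have "has_exact_period ?N n (Aff 0)" using norm_pair_exact_period[OF c] n bc(1) by simp
  ultimately show "C \<in> Per_zero n" using norm_pair_critical[OF c] unfolding Per_zero_def by blast
next
  fix C assume "C \<in> Per_zero n"
  then obtain f x where C: "C \<in> M2" "f \<in> C" and x: "critical_point f x" "has_exact_period f n x"
    unfolding Per_zero_def by blast
  obtain f0 where "C = conj_rel `` {f0}" using C(1) unfolding M2_def by (rule quotientE)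
  then have "(f0, f) \<in> conj_rel" and Cf: "C = conj_rel `` {f}"
    using C(2) equiv_class_eq[OF equiv_conj_rel] by auto
  then have f: "f \<in> rational_maps 2" by (simp add: conj_rel_def)
  have per: "(f ^^ n) x = x" and min: "\<And>k. 0 < k \<Longrightarrow> k < n \<Longrightarrow> (f ^^ k) x \<noteq> x"
    using x(2) by (auto simp: has_exact_period_def)
  have x01: "x \<noteq> f x" using min[of 1] n by simp
  have x02: "x \<noteq> f (f x)" using min[of 2] n by (simp add: numeral_2_eq_2)
  have x12: "f x \<noteq> f (f x)"
  proof
    assume "f x = f (f x)"
    then have "(f ^^ k) (f x) = f x" for k by (induction k) auto
    from this[of "n - 1"] have "(f ^^ n) x = f x" using n by (metis funpow_simps_right(2) Suc_diff_1 comp_apply less_le_trans zero_less_numeral)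
    then show False using per x01 by simp
  qed
  obtain \<mu> where \<mu>: "\<mu> \<in> rational_maps 1" "\<mu> x = Aff 0" "\<mu> (f x) = Infty" "\<mu> (f (f x)) = Aff 1"
    using mob_three_points[OF x01 x02 x12] by blast
  obtain \<nu> where \<nu>: "\<nu> \<in> rational_maps 1" "\<mu> \<circ> \<nu> = id" "\<nu> \<circ> \<mu> = id" using rational_maps_1_group(3)[OF \<mu>(1)] by blast
  have \<nu>\<mu>: "\<nu> (\<mu> z) = z" "\<mu> (\<nu> z) = z" for z using \<nu>(2,3) by (metis comp_apply id_apply)+
  define g where "g = \<mu> \<circ> f \<circ> \<nu>"
  have g: "g \<in> rational_maps 2" unfolding g_def by (rule rational_maps_2_comp[OF f \<mu>(1) \<nu>(1)])
  have g\<mu>: "g (\<mu> z) = \<mu> (f z)" for z by (simp add: g_def \<nu>\<mu>)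
  have uniq: "y = Aff 0" if "g y = Infty" for y
  proof -
    have "\<mu> (f (\<nu> y)) = \<mu> (f x)" using that \<mu>(3) by (simp add: g_def)
    then have "f (\<nu> y) = f x" by (metis \<nu>\<mu>(1))
    then have "\<nu> y = x" by (rule critical_point_unique_preimage[OF f x(1)])
    then show ?thesis using \<mu>(2) \<nu>\<mu>(2) by metis
  qed
  have g0: "g (Aff 0) = Infty" "g Infty = Aff 1" using g\<mu>[of x] g\<mu>[of "f x"] \<mu> by simp_all
  obtain b c where c: "c \<noteq> 0" "g = ratmap (norm_pair b c)" using normal_form[OF g g0 uniq] by metis
  have iter: "(g ^^ k) (\<mu> z) = \<mu> ((f ^^ k) z)" for k z by (induction k) (simp_all add: g\<mu>)
  have "has_exact_period g n (\<mu> x)"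
    unfolding has_exact_period_def iter using per min n \<nu>\<mu>(1) by (metis less_le_trans zero_less_numeral)
  then have "(b, c) \<in> per_params n" using norm_pair_exact_period[OF c(1), of n b] n c(2) \<mu>(2) by simp
  moreover have "\<mu> \<circ> f = g \<circ> \<mu>" by (rule ext) (simp add: g\<mu>)
  then have "(f, g) \<in> conj_rel" using f g \<mu>(1) by (auto simp: conj_rel_def)
  then have "C = conj_class_of_pair (norm_pair b c)"
    unfolding Cf conj_class_of_pair_def c(2) by (rule equiv_class_eq[OF equiv_conj_rel])
  ultimately show "C \<in> (\<lambda>(b, c). conj_class_of_pair (norm_pair b c)) ` per_params n" by force
qed

section \<open>Zariski-closed sets seen in the parameter plane\<close>

lemma coeff_polyfun_norm_pair:
  assumes "coeff_polyfun F"
  obtains P where "\<And>b c. F (norm_pair b c) = ev P b c"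
proof -
  have var: "\<exists>P. \<forall>b c. coeff (fst (norm_pair b c)) i = ev P b c" for i
  proof -
    have e: "ev [:0, 1:] b c = c" "ev [:[:0, 1:]:] b c = b" "ev 1 b c = 1" "ev 0 b c = 0" for b c
      by (rule eval2_vars[OF ring_hom_fun_id] ev_simps)+
    consider "i = 0" | "i = 1" | "i = 2" | "i > 2" by linarith
    then show ?thesis
    proof cases
      case 1 then show ?thesis using e(1) by (intro exI[of _ "[:0, 1:]"]) (simp add: norm_pair_def)
    next
      case 2 then show ?thesis using e(2) by (intro exI[of _ "[:[:0, 1:]:]"]) (simp add: norm_pair_def)
    next
      case 3 then show ?thesis using e(3) by (intro exI[of _ 1]) (simp add: norm_pair_def numeral_2_eq_2)
    next
      case 4 then show ?thesis using e(4) by (intro exI[of _ 0]) (simp add: norm_pair_def coeff_eq_0)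
    qed
  qed
  have const: "\<exists>P. \<forall>b c. k = ev P b c" for k
    by (rule exI[of _ "[:[:k:]:]"]) (simp add: eval2_const[OF ring_hom_fun_id])
  have "\<exists>P. \<forall>b c. F (norm_pair b c) = ev P b c" using assms
  proof induction
    case (add F G)
    then obtain P R where "\<forall>b c. F (norm_pair b c) = ev P b c" "\<forall>b c. G (norm_pair b c) = ev R b c" by blast
    then show ?case by (intro exI[of _ "P + R"]) (simp add: ev_simps)
  next
    case (mult F G)
    then obtain P R where "\<forall>b c. F (norm_pair b c) = ev P b c" "\<forall>b c. G (norm_pair b c) = ev R b c" by blast
    then show ?case by (intro exI[of _ "P * R"]) (simp add: ev_simps)
  next
    case (denom i)
    show ?case unfolding norm_pair_def snd_conv by (rule const)
  qed (auto simp: var const)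
  then show ?thesis using that by blast
qed

text \<open>The complement of \<open>T\<close> pulls back to a union of nonvanishing loci of
  polynomial functions of the coefficients, one of which contains
  \<open>norm_pair b c\<close>.\<close>

lemma closedin_M2_separate:
  assumes "closedin zariski_M2 T" "c \<noteq> 0" "conj_class_of_pair (norm_pair b c) \<notin> T"
  obtains P where "ev P b c \<noteq> 0"
    "\<And>b' c'. c' \<noteq> 0 \<Longrightarrow> conj_class_of_pair (norm_pair b' c') \<in> T \<Longrightarrow> ev P b' c' = 0"
proof -
  have "openin zariski_M2 (M2 - T)" using assms(1) by (simp add: closedin_def)
  then obtain \<F> where F: "\<forall>F\<in>\<F>. coeff_polyfun F"
    "{r \<in> coprime_pairs 2. conj_class_of_pair r \<in> M2 - T} = {r \<in> coprime_pairs 2. \<exists>F\<in>\<F>. F r \<noteq> 0}"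
    unfolding openin_zariski_M2 openin_zariski_pairs by blast
  have M2: "conj_class_of_pair (norm_pair b' c') \<in> M2" if "c' \<noteq> 0" for b' c'
    using conj_class_of_pair_image norm_pair_coprime[OF that] by blast
  have "norm_pair b c \<in> {r \<in> coprime_pairs 2. conj_class_of_pair r \<in> M2 - T}"
    using assms M2 norm_pair_coprime by simp
  then obtain F0 where F0: "F0 \<in> \<F>" "F0 (norm_pair b c) \<noteq> 0" unfolding F(2) by blast
  obtain P where P: "\<And>b c. F0 (norm_pair b c) = ev P b c" using coeff_polyfun_norm_pair F(1) F0(1) by metis
  have "ev P b' c' = 0" if "c' \<noteq> 0" "conj_class_of_pair (norm_pair b' c') \<in> T" for b' c'
  proof (rule ccontr)
    assume "ev P b' c' \<noteq> 0"
    then have "norm_pair b' c' \<in> {r \<in> coprime_pairs 2. \<exists>F\<in>\<F>. F r \<noteq> 0}"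
      using P norm_pair_coprime[OF that(1)] by (auto intro!: bexI[OF _ F0(1)])
    then show False using that(2) unfolding F(2)[symmetric] by blast
  qed
  then show ?thesis using that P F0(2) by metis
qed

theorem theorem1p1:
  fixes n :: nat and G :: "rat poly"
  assumes "n \<ge> 4"
    and "is_gleason_poly n G"
    and "irreducible G"
  shows "irreducible_space (subtopology zariski_M2 (Per_zero n))"
proof -
  have n: "n \<ge> 3" using assms(1) by simp
  let ?S = "Per_zero n"
  have S: "topspace (subtopology zariski_M2 ?S) = ?S" by (auto simp: Per_zero_def)
  have "?S \<noteq> {}" unfolding Per_zero_eq[OF n] using per_params_nonempty[OF n assms(2,3)] by blast
  moreover have "A = ?S \<or> B = ?S"
    if AB: "closedin (subtopology zariski_M2 ?S) A" "closedin (subtopology zariski_M2 ?S) B" "A \<union> B = ?S" for A B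
  proof (rule ccontr)
    assume "\<not> (A = ?S \<or> B = ?S)"
    \<comment> \<open>Classes missed by \<open>A\<close> and by \<open>B\<close> yield
      \<open>P\<close> and \<open>R\<close>, neither vanishing on all parameters although their
      product does: a continuous image of an irreducible set is irreducible.\<close>
    then obtain C C' where C: "C \<in> ?S" "C \<notin> A" "C' \<in> ?S" "C' \<notin> B" using AB(3) by blast
    obtain T T' where T: "closedin zariski_M2 T" "A = T \<inter> ?S" "closedin zariski_M2 T'" "B = T' \<inter> ?S"
      using AB(1,2) unfolding closedin_subtopology by blast
    obtain b c b' c' where bc: "(b, c) \<in> per_params n" "C = conj_class_of_pair (norm_pair b c)"
      "(b', c') \<in> per_params n" "C' = conj_class_of_pair (norm_pair b' c')"
      using C(1,3) unfolding Per_zero_eq[OF n] by auto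
    have c: "c \<noteq> 0" "c' \<noteq> 0" using bc by (auto simp: per_params_def)
    obtain P where P: "ev P b c \<noteq> 0"
      "\<And>x y. y \<noteq> 0 \<Longrightarrow> conj_class_of_pair (norm_pair x y) \<in> T \<Longrightarrow> ev P x y = 0"
      using closedin_M2_separate[OF T(1) c(1), of b] C bc T(2) by blast
    obtain R where R: "ev R b' c' \<noteq> 0"
      "\<And>x y. y \<noteq> 0 \<Longrightarrow> conj_class_of_pair (norm_pair x y) \<in> T' \<Longrightarrow> ev R x y = 0"
      using closedin_M2_separate[OF T(3) c(2), of b'] C bc T(4) by blast
    have "ev P x y = 0 \<or> ev R x y = 0" if xy: "(x, y) \<in> per_params n" for x y
    proof -
      have "conj_class_of_pair (norm_pair x y) \<in> ?S" unfolding Per_zero_eq[OF n] using xy by force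
      moreover have "y \<noteq> 0" using xy by (simp add: per_params_def)
      ultimately show ?thesis using P(2) R(2) AB(3) T(2,4) by blast
    qed
    from per_params_irreducible[OF n assms(2,3) this] show False using P(1) R(1) bc(1,3) by blast
  qed
  ultimately show ?thesis unfolding irreducible_space_def S by blast
qed

end
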